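(* Let $\mathbf{G}=(G,\delta,\epsilon)$ be a comonad on a category $\mathcal{A}$ and let $\mathbf{G}_\bullet$ be the associated simplicial endofunctor. Suppose $t:GG\Rightarrow GG$ is an invertible natural transformation such that for every object $M$ of $\mathcal{A}$: (i) $G(\epsilon_M)\circ t_M=\epsilon_{GM}$; (ii) $\epsilon_{GM}\circ t_M=G(\epsilon_M)$; (iii) $G(\delta_M)\circ t_M=t_{GM}\circ G(t_M)\circ\delta_{GM}$; (iv) $\delta_{GM}\circ t_M=t_{GM}\circ G(t_M)\circ t_{GM}\circ G(t_M)\circ G(\delta_M)$; (v) (quantum Yang–Baxter equation) $G(t_M)\circ t_{GM}\circ G(t_M)=t_{GM}\circ G(t_M)\circ t_{GM}$; (vi) $t_M\circ t_M\circ t_M\circ\delta_M=t_M\circ\delta_M$. For $n\ge1$ define $t_n:G^{n+1}\Rightarrow G^{n+1}$ by $t_{n,M}:=t_{G^{n-1}M}\circ G(t_{G^{n-2}M})\circ\cdots\circ G^{n-1}(t_M)$. Assume in addition that $t^2=1$. Then $t_n^{n+1}=1$ for all $n\geq 1$ as well, and hence $\mathbf{G}_\bullet\stackrel{\epsilon}{\Rightarrow}\mathrm{Id}_{\mathcal{A}}$ with the operators $t_n$ is an augmented cyclic object in the category $\mathrm{End}\,\mathcal{A}$ of endofunctors of $\mathcal{A}$.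
   Context: A comonad on $\mathcal{A}$ is a triple $\mathbf{G}=(G,\delta,\epsilon)$ with $G:\mathcal{A}\to\mathcal{A}$ a functor and $\delta:G\Rightarrow G^2$, $\epsilon:G\Rightarrow \mathrm{Id}_{\mathcal{A}}$ natural transformations satisfying $\delta_{GM}\circ\delta_M=G(\delta_M)\circ\delta_M$ and $\epsilon_{GM}\circ\delta_M=G(\epsilon_M)\circ\delta_M=1_{GM}$ for all objects $M$. The associated simplicial endofunctor $\mathbf{G}_\bullet$ is the simplicial object in $\mathrm{End}\,\mathcal{A}$ with $\mathbf{G}_n=G^{n+1}$, faces $\partial_i=\partial_i^n=G^i(\epsilon_{G^{n-i}}):G^{n+1}\Rightarrow G^n$ and degeneracies $\sigma_i=\sigma_i^n=G^i(\delta_{G^{n-i}}):G^{n+1}\Rightarrow G^{n+2}$, $0\le i\le n$. It is augmented by $\epsilon:\mathbf{G}_0=G\Rightarrow \mathrm{Id}_{\mathcal{A}}$, meaning $\epsilon\circ\partial_0^1=\epsilon\circ\partial_1^1$. A paracyclic object in a category is a simplicial object $F_\bullet$ together with isomorphisms $t_n:F_n\to F_n$, $n\ge1$, such that (with the convention $t_0=\mathrm{id}$), for $n\ge1$ and $0<i\le n$: $$\partial_i t_n=t_{n-1}\partial_{i-1},\quad \sigma_i t_n=t_{n+1}\sigma_{i-1},\quad \partial_0t_n=\partial_n,\quad \sigma_0t_n=t_{n+1}^2\sigma_n.$$ It is cyclic if in addition $t_n^{n+1}=1$ for all $n$. An augmented (para)cyclic object is a (para)cyclic object whose underlying simplicial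 object is equipped with an augmentation. *)

theory Defs
  imports "HOL-Library.FuncSet"
begin

text \<open>The objects and arrows of a category form sets over arbitrary types. Only the values of the
  operations on these sets matter; \<open>g \<cdot> f\<close> is the composite ``first \<open>f\<close>, then \<open>g\<close>''.\<close>

record ('o, 'm) cat =
  Obj :: "'o set"
  Arr :: "'m set"
  Src :: "'m \<Rightarrow> 'o"
  Tgt :: "'m \<Rightarrow> 'o"
  Ident :: "'o \<Rightarrow> 'm"
  Compose :: "'m \<Rightarrow> 'm \<Rightarrow> 'm"  (infixr "\<cdot>\<index>" 70)

definition Hom :: "('o, 'm) cat \<Rightarrow> 'o \<Rightarrow> 'o \<Rightarrow> 'm set" where
  "Hom C a b = {f \<in> Arr C. Src C f = a \<and> Tgt C f = b}"

locale category =
  fixes C :: "('o, 'm) cat" (structure)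
  assumes Src_in [simp]: "f \<in> Arr C \<Longrightarrow> Src C f \<in> Obj C"
    and Tgt_in [simp]: "f \<in> Arr C \<Longrightarrow> Tgt C f \<in> Obj C"
    and Ident_in: "a \<in> Obj C \<Longrightarrow> Ident C a \<in> Hom C a a"
    and Compose_in: "f \<in> Hom C a b \<Longrightarrow> g \<in> Hom C b c \<Longrightarrow> g \<cdot> f \<in> Hom C a c"
    and Ident_right: "f \<in> Hom C a b \<Longrightarrow> f \<cdot> Ident C a = f"
    and Ident_left: "f \<in> Hom C a b \<Longrightarrow> Ident C b \<cdot> f = f"
    and Compose_assoc: "f \<in> Hom C a b \<Longrightarrow> g \<in> Hom C b c \<Longrightarrow> h \<in> Hom C c d \<Longrightarrow>
      (h \<cdot> g) \<cdot> f = h \<cdot> (g \<cdot> f)"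

definition iso_in :: "('o, 'm) cat \<Rightarrow> 'o \<Rightarrow> 'o \<Rightarrow> 'm set" where
  "iso_in C a b = {f \<in> Hom C a b. \<exists>g \<in> Hom C b a.
     g \<cdot>\<^bsub>C\<^esub> f = Ident C a \<and> f \<cdot>\<^bsub>C\<^esub> g = Ident C b}"

primrec arr_pow :: "('o, 'm) cat \<Rightarrow> 'm \<Rightarrow> nat \<Rightarrow> 'm" where
  "arr_pow C f 0 = Ident C (Src C f)"
| "arr_pow C f (Suc n) = f \<cdot>\<^bsub>C\<^esub> arr_pow C f n"

text \<open>The object and arrow maps of a functor, and the components of a natural transformation, are
  required to be \<open>undefined\<close> off the source category. Hence HOL equality of functors and of natural
  transformations is the mathematical one.\<close>

record ('o, 'm, 'p, 'q) fctr =
  FObj :: "'o \<Rightarrow> 'p"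
  FArr :: "'m \<Rightarrow> 'q"

locale is_functor = A: category A + B: category B
  for A :: "('o, 'm) cat" and B :: "('p, 'q) cat" +
  fixes F :: "('o, 'm, 'p, 'q) fctr"
  assumes FObj_ext: "FObj F \<in> extensional (Obj A)"
    and FArr_ext: "FArr F \<in> extensional (Arr A)"
    and FObj_in: "a \<in> Obj A \<Longrightarrow> FObj F a \<in> Obj B"
    and FArr_in: "f \<in> Hom A a b \<Longrightarrow> FArr F f \<in> Hom B (FObj F a) (FObj F b)"
    and FArr_Ident: "a \<in> Obj A \<Longrightarrow> FArr F (Ident A a) = Ident B (FObj F a)"
    and FArr_Compose: "f \<in> Hom A a b \<Longrightarrow> g \<in> Hom A b c \<Longrightarrow>
      FArr F (g \<cdot>\<^bsub>A\<^esub> f) = FArr F g \<cdot>\<^bsub>B\<^esub> FArr F f"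

definition id_fctr :: "('o, 'm) cat \<Rightarrow> ('o, 'm, 'o, 'm) fctr" where
  "id_fctr A = \<lparr>FObj = (\<lambda>a\<in>Obj A. a), FArr = (\<lambda>f\<in>Arr A. f)\<rparr>"

definition comp_fctr :: "('o, 'm) cat \<Rightarrow> ('p, 'q, 'r, 's) fctr \<Rightarrow> ('o, 'm, 'p, 'q) fctr \<Rightarrow>
    ('o, 'm, 'r, 's) fctr" where
  "comp_fctr A H F = \<lparr>FObj = (\<lambda>a\<in>Obj A. FObj H (FObj F a)),
                      FArr = (\<lambda>f\<in>Arr A. FArr H (FArr F f))\<rparr>"

primrec fctr_pow :: "('o, 'm) cat \<Rightarrow> ('o, 'm, 'o, 'm) fctr \<Rightarrow> nat \<Rightarrow> ('o, 'm, 'o, 'm) fctr" where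
  "fctr_pow A G 0 = id_fctr A"
| "fctr_pow A G (Suc n) = comp_fctr A G (fctr_pow A G n)"

record ('o, 'm, 'p, 'q) ntrans =
  NSrc :: "('o, 'm, 'p, 'q) fctr"
  NTgt :: "('o, 'm, 'p, 'q) fctr"
  Cpt :: "'o \<Rightarrow> 'q"

locale is_ntrans = S: is_functor A B "NSrc \<tau>" + T: is_functor A B "NTgt \<tau>"
  for A :: "('o, 'm) cat" and B :: "('p, 'q) cat" and \<tau> :: "('o, 'm, 'p, 'q) ntrans" +
  assumes Cpt_ext: "Cpt \<tau> \<in> extensional (Obj A)"
    and Cpt_in: "a \<in> Obj A \<Longrightarrow> Cpt \<tau> a \<in> Hom B (FObj (NSrc \<tau>) a) (FObj (NTgt \<tau>) a)"
    and naturality: "f \<in> Hom A a b \<Longrightarrow>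
      Cpt \<tau> b \<cdot>\<^bsub>B\<^esub> FArr (NSrc \<tau>) f = FArr (NTgt \<tau>) f \<cdot>\<^bsub>B\<^esub> Cpt \<tau> a"

definition fctr_cat :: "('o, 'm) cat \<Rightarrow> ('p, 'q) cat \<Rightarrow>
    (('o, 'm, 'p, 'q) fctr, ('o, 'm, 'p, 'q) ntrans) cat" where
  "fctr_cat A B = \<lparr>
     Obj = {F. is_functor A B F},
     Arr = {\<tau>. is_ntrans A B \<tau>},
     Src = NSrc,
     Tgt = NTgt,
     Ident = (\<lambda>F. \<lparr>NSrc = F, NTgt = F, Cpt = (\<lambda>a\<in>Obj A. Ident B (FObj F a))\<rparr>),
     Compose = (\<lambda>\<tau> \<rho>. \<lparr>NSrc = NSrc \<rho>, NTgt = NTgt \<tau>,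
                        Cpt = (\<lambda>a\<in>Obj A. Cpt \<tau> a \<cdot>\<^bsub>B\<^esub> Cpt \<rho> a)\<rparr>)\<rparr>"

abbreviation End_cat :: "('o, 'm) cat \<Rightarrow> (('o, 'm, 'o, 'm) fctr, ('o, 'm, 'o, 'm) ntrans) cat" where
  "End_cat A \<equiv> fctr_cat A A"

text \<open>\<open>whisker A H \<tau> F\<close> is the natural transformation with components \<open>H (\<tau>\<^bsub>F M\<^esub>)\<close>, where \<open>A\<close> is
  the source category of \<open>F\<close>.\<close>

definition whisker :: "('o, 'm) cat \<Rightarrow> ('r, 's, 'u, 'v) fctr \<Rightarrow> ('p, 'q, 'r, 's) ntrans \<Rightarrow>
    ('o, 'm, 'p, 'q) fctr \<Rightarrow> ('o, 'm, 'u, 'v) ntrans" where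
  "whisker A H \<tau> F = \<lparr>
     NSrc = comp_fctr A H (comp_fctr A (NSrc \<tau>) F),
     NTgt = comp_fctr A H (comp_fctr A (NTgt \<tau>) F),
     Cpt = (\<lambda>M\<in>Obj A. FArr H (Cpt \<tau> (FObj F M)))\<rparr>"

text \<open>\<open>d n i\<close> and \<open>s n i\<close> are the face and degeneracy operators with source \<open>X n\<close>; their values
  outside \<open>i \<le> n\<close>, and the values \<open>d 0 i\<close>, are irrelevant.\<close>

locale simplicial_object = category C
  for C :: "('o, 'm) cat" (structure) +
  fixes X :: "nat \<Rightarrow> 'o" and d s :: "nat \<Rightarrow> nat \<Rightarrow> 'm"
  assumes X_in: "X n \<in> Obj C"
    and d_in: "i \<le> Suc n \<Longrightarrow> d (Suc n) i \<in> Hom C (X (Suc n)) (X n)"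
    and s_in: "i \<le> n \<Longrightarrow> s n i \<in> Hom C (X n) (X (Suc n))"
    and d_d: "i < j \<Longrightarrow> j \<le> Suc (Suc n) \<Longrightarrow>
      d (Suc n) i \<cdot> d (Suc (Suc n)) j = d (Suc n) (j - 1) \<cdot> d (Suc (Suc n)) i"
    and s_s: "i \<le> j \<Longrightarrow> j \<le> n \<Longrightarrow> s (Suc n) i \<cdot> s n j = s (Suc n) (Suc j) \<cdot> s n i"
    and d_s_less: "i < j \<Longrightarrow> j \<le> Suc n \<Longrightarrow>
      d (Suc (Suc n)) i \<cdot> s (Suc n) j = s n (j - 1) \<cdot> d (Suc n) i"
    and d_s_eq: "j \<le> n \<Longrightarrow> d (Suc n) j \<cdot> s n j = Ident C (X n)"
    and d_s_Suc: "j \<le> n \<Longrightarrow> d (Suc n) (Suc j) \<cdot> s n j = Ident C (X n)"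
    and d_s_greater: "Suc j < i \<Longrightarrow> i \<le> Suc (Suc n) \<Longrightarrow>
      d (Suc (Suc n)) i \<cdot> s (Suc n) j = s n j \<cdot> d (Suc n) (i - 1)"

locale augmented_simplicial_object = simplicial_object C X d s
  for C :: "('o, 'm) cat" (structure) and X d s +
  fixes Y :: 'o and e :: 'm
  assumes Y_in: "Y \<in> Obj C"
    and e_in: "e \<in> Hom C (X 0) Y"
    and e_d: "e \<cdot> d 1 0 = e \<cdot> d 1 1"

locale paracyclic_object = simplicial_object C X d s
  for C :: "('o, 'm) cat" (structure) and X d s +
  fixes t :: "nat \<Rightarrow> 'm"
  assumes t_0: "t 0 = Ident C (X 0)"
    and t_iso: "n \<ge> 1 \<Longrightarrow> t n \<in> iso_in C (X n) (X n)"
    and d_t: "n \<ge> 1 \<Longrightarrow> 0 < i \<Longrightarrow> i \<le> n \<Longrightarrow> d n i \<cdot> t n = t (n - 1) \<cdot> d n (i - 1)"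
    and s_t: "n \<ge> 1 \<Longrightarrow> 0 < i \<Longrightarrow> i \<le> n \<Longrightarrow> s n i \<cdot> t n = t (n + 1) \<cdot> s n (i - 1)"
    and d_0_t: "n \<ge> 1 \<Longrightarrow> d n 0 \<cdot> t n = d n n"
    and s_0_t: "n \<ge> 1 \<Longrightarrow> s n 0 \<cdot> t n = arr_pow C (t (n + 1)) 2 \<cdot> s n n"

locale cyclic_object = paracyclic_object C X d s t
  for C :: "('o, 'm) cat" (structure) and X d s t +
  assumes t_cyclic: "arr_pow C (t n) (n + 1) = Ident C (X n)"

locale augmented_cyclic_object = cyclic_object C X d s t + augmented_simplicial_object C X d s Y e
  for C :: "('o, 'm) cat" (structure) and X d s t Y e

locale comonad = category A
  for A :: "('o, 'm) cat" (structure) +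
  fixes G :: "('o, 'm, 'o, 'm) fctr" and \<delta> \<epsilon> :: "('o, 'm, 'o, 'm) ntrans"
  assumes G_functor: "is_functor A A G"
    and \<delta>_in: "\<delta> \<in> Hom (End_cat A) G (comp_fctr A G G)"
    and \<epsilon>_in: "\<epsilon> \<in> Hom (End_cat A) G (id_fctr A)"
    and coassoc: "M \<in> Obj A \<Longrightarrow>
      Cpt \<delta> (FObj G M) \<cdot> Cpt \<delta> M = FArr G (Cpt \<delta> M) \<cdot> Cpt \<delta> M"
    and counit_left: "M \<in> Obj A \<Longrightarrow> Cpt \<epsilon> (FObj G M) \<cdot> Cpt \<delta> M = Ident A (FObj G M)"
    and counit_right: "M \<in> Obj A \<Longrightarrow> FArr G (Cpt \<epsilon> M) \<cdot> Cpt \<delta> M = Ident A (FObj G M)"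

definition comonad_obj :: "('o, 'm) cat \<Rightarrow> ('o, 'm, 'o, 'm) fctr \<Rightarrow>
    nat \<Rightarrow> ('o, 'm, 'o, 'm) fctr" where
  "comonad_obj A G n = fctr_pow A G (n + 1)"

definition comonad_face :: "('o, 'm) cat \<Rightarrow> ('o, 'm, 'o, 'm) fctr \<Rightarrow> ('o, 'm, 'o, 'm) ntrans \<Rightarrow>
    nat \<Rightarrow> nat \<Rightarrow> ('o, 'm, 'o, 'm) ntrans" where
  "comonad_face A G \<epsilon> n i = whisker A (fctr_pow A G i) \<epsilon> (fctr_pow A G (n - i))"

definition comonad_degen :: "('o, 'm) cat \<Rightarrow> ('o, 'm, 'o, 'm) fctr \<Rightarrow> ('o, 'm, 'o, 'm) ntrans \<Rightarrow>
    nat \<Rightarrow> nat \<Rightarrow> ('o, 'm, 'o, 'm) ntrans" where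
  "comonad_degen A G \<delta> n i = whisker A (fctr_pow A G i) \<delta> (fctr_pow A G (n - i))"

text \<open>\<open>twist_prod A G t n k\<close> is the product of the first \<open>k\<close> factors of
  \<open>t\<^bsub>G^(n-1) M\<^esub> \<circ> G (t\<^bsub>G^(n-2) M\<^esub>) \<circ> \<dots> \<circ> G^(n-1) (t\<^bsub>M\<^esub>)\<close>. For \<open>k = n = 0\<close> it is the identity of \<open>G\<close>,
  in accordance with the convention \<open>t\<^sub>0 = id\<close>.\<close>

primrec twist_prod :: "('o, 'm) cat \<Rightarrow> ('o, 'm, 'o, 'm) fctr \<Rightarrow> ('o, 'm, 'o, 'm) ntrans \<Rightarrow>
    nat \<Rightarrow> nat \<Rightarrow> ('o, 'm, 'o, 'm) ntrans" where
  "twist_prod A G t n 0 = Ident (End_cat A) (fctr_pow A G (n + 1))"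
| "twist_prod A G t n (Suc k) = twist_prod A G t n k \<cdot>\<^bsub>End_cat A\<^esub>
     whisker A (fctr_pow A G k) t (fctr_pow A G (n - Suc k))"

definition twist_op :: "('o, 'm) cat \<Rightarrow> ('o, 'm, 'o, 'm) fctr \<Rightarrow> ('o, 'm, 'o, 'm) ntrans \<Rightarrow>
    nat \<Rightarrow> ('o, 'm, 'o, 'm) ntrans" where
  "twist_op A G t n = twist_prod A G t n n"

end

theory Submission
  imports Defs
begin

text \<open>Regard \<open>G\<^bsup>n+1\<^esup>\<close> as \<open>n + 1\<close> parallel strands. Then \<open>\<epsilon>\<close> deletes a strand, \<open>\<delta>\<close> doubles it and \<open>t\<close>
  lets two adjacent strands cross. Let \<open>\<tau>\<^sub>k\<close> be the crossing of the strands \<open>k\<close> and \<open>k + 1\<close>. The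
  Yang-Baxter equation, \<open>t\<^sup>2 = 1\<close> and the interchange law for natural transformations say that
  \<open>\<tau>\<^sub>0, \<dots>, \<tau>\<^bsub>n-1\<^esub>\<close> satisfy the Coxeter relations of the symmetric group on \<open>n + 1\<close> letters. The
  operator \<open>t\<^sub>n = \<tau>\<^sub>0 \<tau>\<^sub>1 \<dots> \<tau>\<^bsub>n-1\<^esub>\<close> is the Coxeter element, that is, the cyclic rotation of the
  strands.

  The order of \<open>t\<^sub>n\<close> is thus a fact about these relations (\<open>coxeter_element_order\<close>). From
  \<open>\<tau>\<^sub>i t\<^sub>n = t\<^sub>n \<tau>\<^bsub>i-1\<^esub>\<close> one obtains \<open>t\<^sub>n\<^bsup>k\<^esup> = (\<tau>\<^sub>0 \<dots> \<tau>\<^bsub>n-2\<^esub>)\<^bsup>k\<^esup> \<tau>\<^bsub>n-1\<^esub> \<dots> \<tau>\<^bsub>n-k\<^esub>\<close> for \<open>k \<le> n\<close>. For \<open>k = n\<close>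
  the first factor is the identity by induction, and the second is the product of the same
  involutions in reverse order, the inverse of \<open>t\<^sub>n\<close>.

  For the relations \<open>\<partial>\<^sub>i t\<^sub>n = t\<^bsub>n-1\<^esub> \<partial>\<^bsub>i-1\<^esub>\<close> and \<open>\<sigma>\<^sub>i t\<^sub>n = t\<^bsub>n+1\<^esub> \<sigma>\<^bsub>i-1\<^esub>\<close> with \<open>i > 0\<close>, the operator on the
  left moves through the crossings one at a time: it commutes with those of other strands, and at
  the single crossing of its own strand with the rotating one the compatibility of \<open>t\<close> with \<open>\<epsilon>\<close> or
  \<open>\<delta>\<close> applies (\<open>face_twist_prod\<close>, \<open>degen_twist_prod\<close>). The relations for \<open>i = 0\<close> and the
  invertibility of \<open>t\<^sub>n\<close> follow formally from these and from \<open>t\<^sub>n\<^bsup>n+1\<^esup> = 1\<close> (\<open>cyclic_objectI\<close>).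

  All computations take place in the category of endofunctors, with the rules for whiskering by
  powers of \<open>G\<close>; objects of \<open>A\<close> occur only where the hypotheses on \<open>\<epsilon>\<close>, \<open>\<delta>\<close> and \<open>t\<close> are turned into
  equations of natural transformations.\<close>

section \<open>Endomorphisms in a category\<close>

context category
begin

lemma Hom_Arr: "f \<in> Hom C a b \<Longrightarrow> f \<in> Arr C \<and> Src C f = a \<and> Tgt C f = b"
  by (simp add: Hom_def)

lemma Hom_Obj: "f \<in> Hom C a b \<Longrightarrow> a \<in> Obj C \<and> b \<in> Obj C"
  by (auto simp: Hom_def)

lemma arr_pow_0: "f \<in> Hom C a a \<Longrightarrow> arr_pow C f 0 = Ident C a"
  by (simp add: Hom_def)

lemma arr_pow_in:
  assumes "f \<in> Hom C a a"
  shows "arr_pow C f n \<in> Hom C a a"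
proof (induction n)
  case 0
  show ?case
    using assms Ident_in Hom_Obj arr_pow_0 by metis
next
  case (Suc n)
  then show ?case
    using assms Compose_in by simp
qed

lemma arr_pow_add:
  assumes f: "f \<in> Hom C a a"
  shows "arr_pow C f (m + n) = arr_pow C f m \<cdot> arr_pow C f n"
proof (induction m)
  case 0
  show ?case
    using arr_pow_0[OF f] Ident_left[OF arr_pow_in[OF f]] by simp
next
  case (Suc m)
  then show ?case
    using Compose_assoc[OF arr_pow_in[OF f] arr_pow_in[OF f] f] by simp
qed

lemma arr_pow_1: "f \<in> Hom C a a \<Longrightarrow> arr_pow C f (Suc 0) = f"
  using arr_pow_0 Ident_right by simp

lemma arr_pow_Suc_right:
  "f \<in> Hom C a a \<Longrightarrow> arr_pow C f (Suc n) = arr_pow C f n \<cdot> f"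
  using arr_pow_add[of f a n 1] arr_pow_1 by simp

text \<open>Each passage of \<open>x\<close> through the family \<open>f\<close> lowers the index by one, so the top member turns into
  the bottom one after \<open>n\<close> passages. This is how the relations for \<open>\<partial>\<^sub>0\<close> and \<open>\<sigma>\<^sub>0\<close> in a cyclic object
  are recovered from those with positive index.\<close>

lemma slide_power:
  assumes f: "\<And>i. i \<le> n \<Longrightarrow> f i \<in> Hom C a b"
    and x: "x \<in> Hom C a a" and y: "y \<in> Hom C b b"
    and slide: "\<And>i. 0 < i \<Longrightarrow> i \<le> n \<Longrightarrow> f i \<cdot> x = y \<cdot> f (i - 1)"
    and "k \<le> n"
  shows "f n \<cdot> arr_pow C x k = arr_pow C y k \<cdot> f (n - k)"
  using \<open>k \<le> n\<close>
proof (induction k)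
  case 0
  have "f n \<in> Hom C a b"
    using f by simp
  then show ?case
    using arr_pow_0[OF x] arr_pow_0[OF y] Ident_left Ident_right by simp
next
  case (Suc k)
  let ?g = "f (n - k)" and ?h = "f (n - Suc k)"
  have g: "?g \<in> Hom C a b" and h: "?h \<in> Hom C a b" and fn: "f n \<in> Hom C a b"
    using f by simp_all
  have "f n \<cdot> arr_pow C x (Suc k) = (f n \<cdot> arr_pow C x k) \<cdot> x"
    unfolding arr_pow_Suc_right[OF x] using Compose_assoc[OF x arr_pow_in[OF x] fn] by simp
  also have "\<dots> = (arr_pow C y k \<cdot> ?g) \<cdot> x"
    using Suc by simp
  also have "\<dots> = arr_pow C y k \<cdot> (?g \<cdot> x)"
    using Compose_assoc[OF x g arr_pow_in[OF y]] .
  also have "?g \<cdot> x = y \<cdot> ?h"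
    using slide[of "n - k"] Suc.prems by simp
  also have "arr_pow C y k \<cdot> (y \<cdot> ?h) = arr_pow C y (Suc k) \<cdot> ?h"
    unfolding arr_pow_Suc_right[OF y] using Compose_assoc[OF h y arr_pow_in[OF y]] by simp
  finally show ?case .
qed

end

section \<open>The Coxeter element of the symmetric group\<close>

primrec up_prod :: "('o, 'm) cat \<Rightarrow> 'o \<Rightarrow> (nat \<Rightarrow> 'm) \<Rightarrow> nat \<Rightarrow> 'm" where
  "up_prod C a \<tau> 0 = Ident C a"
| "up_prod C a \<tau> (Suc k) = up_prod C a \<tau> k \<cdot>\<^bsub>C\<^esub> \<tau> k"

text \<open>For involutions the full product \<open>\<tau>\<^bsub>m-1\<^esub> \<dots> \<tau>\<^sub>0\<close>, which is \<open>down_prod C a \<tau> m m\<close>, is inverse to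
  \<open>up_prod C a \<tau> m\<close>. Its initial parts \<open>\<tau>\<^bsub>m-1\<^esub> \<dots> \<tau>\<^bsub>m-k\<^esub>\<close> occur in the powers of \<open>up_prod C a \<tau> m\<close>.\<close>

primrec down_prod :: "('o, 'm) cat \<Rightarrow> 'o \<Rightarrow> (nat \<Rightarrow> 'm) \<Rightarrow> nat \<Rightarrow> nat \<Rightarrow> 'm" where
  "down_prod C a \<tau> m 0 = Ident C a"
| "down_prod C a \<tau> m (Suc k) = down_prod C a \<tau> m k \<cdot>\<^bsub>C\<^esub> \<tau> (m - Suc k)"

text \<open>The relations of the simple transpositions of the symmetric group on \<open>n + 1\<close> letters, for
  endomorphisms of one object. The product of all generators, the Coxeter element, is there an
  \<open>(n + 1)\<close>-cycle, and the order of this cycle has to be derived from the relations alone.\<close>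

locale coxeter_generators = category C
  for C :: "('o, 'm) cat" (structure) +
  fixes a :: 'o and \<tau> :: "nat \<Rightarrow> 'm" and n :: nat
  assumes a_in: "a \<in> Obj C"
    and gen_in: "i < n \<Longrightarrow> \<tau> i \<in> Hom C a a"
    and involution: "i < n \<Longrightarrow> \<tau> i \<cdot> \<tau> i = Ident C a"
    and braid: "Suc i < n \<Longrightarrow> \<tau> (Suc i) \<cdot> \<tau> i \<cdot> \<tau> (Suc i) = \<tau> i \<cdot> \<tau> (Suc i) \<cdot> \<tau> i"
    and far: "Suc i < j \<Longrightarrow> j < n \<Longrightarrow> \<tau> i \<cdot> \<tau> j = \<tau> j \<cdot> \<tau> i"
begin

abbreviation "c \<equiv> up_prod C a \<tau>"
abbreviation "D \<equiv> down_prod C a \<tau>"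

lemma id_in: "Ident C a \<in> Hom C a a"
  using Ident_in a_in .

lemmas endo_in = id_in gen_in Compose_in[of _ a a _ a]
lemmas assoc = Compose_assoc[of _ a a _ a _ a]

lemma c_in: "k \<le> n \<Longrightarrow> c k \<in> Hom C a a"
  by (induction k) (simp_all add: endo_in)

lemma D_in: "m \<le> n \<Longrightarrow> k \<le> m \<Longrightarrow> D m k \<in> Hom C a a"
  by (induction k) (simp_all add: endo_in)

lemma far_c:
  assumes "j < n" "k < j"
  shows "\<tau> j \<cdot> c k = c k \<cdot> \<tau> j"
  using \<open>k < j\<close>
proof (induction k)
  case 0
  then show ?case
    using gen_in[OF \<open>j < n\<close>] by (simp add: Ident_left Ident_right)
next
  case (Suc k)
  have j: "\<tau> j \<in> Hom C a a" and k: "\<tau> k \<in> Hom C a a" and ck: "c k \<in> Hom C a a"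
    using Suc assms gen_in c_in by simp_all
  have "\<tau> j \<cdot> c (Suc k) = (\<tau> j \<cdot> c k) \<cdot> \<tau> k"
    using j k ck by (simp add: assoc)
  also have "\<dots> = c k \<cdot> \<tau> j \<cdot> \<tau> k"
    using Suc j k ck by (simp add: assoc)
  also have "\<dots> = c (Suc k) \<cdot> \<tau> j"
    using far[of k j] Suc assms j k ck by (simp add: assoc)
  finally show ?case .
qed

text \<open>The cycle \<open>c k\<close> conjugates each simple transposition into the next: \<open>\<tau> (Suc i)\<close>
  commutes with the factors before \<open>\<tau> i\<close>, the braid relation turns it into \<open>\<tau> i\<close> as it passes
  \<open>\<tau> i \<cdot> \<tau> (Suc i)\<close>, and \<open>\<tau> i\<close> commutes with the later factors.\<close>

lemma gen_c:
  assumes "Suc i < k" "k \<le> n"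
  shows "\<tau> (Suc i) \<cdot> c k = c k \<cdot> \<tau> i"
proof -
  have "Suc (Suc i) \<le> k"
    using assms by simp
  then show ?thesis
    using \<open>k \<le> n\<close>
  proof (induction k rule: dec_induct)
    case base
    have [intro, simp]: "\<tau> i \<in> Hom C a a" "\<tau> (Suc i) \<in> Hom C a a" "c i \<in> Hom C a a"
      using base gen_in c_in by simp_all
    have "\<tau> (Suc i) \<cdot> c (Suc (Suc i)) = (\<tau> (Suc i) \<cdot> c i) \<cdot> \<tau> i \<cdot> \<tau> (Suc i)"
      by (simp add: assoc endo_in)
    also have "\<dots> = c i \<cdot> \<tau> (Suc i) \<cdot> \<tau> i \<cdot> \<tau> (Suc i)"
      using far_c[of "Suc i" i] base by (simp add: assoc endo_in)
    also have "\<dots> = c i \<cdot> \<tau> i \<cdot> \<tau> (Suc i) \<cdot> \<tau> i"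
      using braid[of i] base by simp
    also have "\<dots> = c (Suc (Suc i)) \<cdot> \<tau> i"
      by (simp add: assoc endo_in)
    finally show ?case .
  next
    case (step k)
    have [intro, simp]: "\<tau> i \<in> Hom C a a" "\<tau> (Suc i) \<in> Hom C a a" "\<tau> k \<in> Hom C a a"
        "c k \<in> Hom C a a"
      using step gen_in c_in by simp_all
    have "\<tau> (Suc i) \<cdot> c (Suc k) = (\<tau> (Suc i) \<cdot> c k) \<cdot> \<tau> k"
      by (simp add: assoc)
    also have "\<dots> = c k \<cdot> \<tau> i \<cdot> \<tau> k"
      using step by (simp add: assoc)
    also have "\<dots> = c (Suc k) \<cdot> \<tau> i"
      using far[of i k] step by (simp add: assoc)
    finally show ?case .
  qed
qed

lemma D_c:
  assumes "Suc m \<le> n" "k \<le> m"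
  shows "D (Suc m) k \<cdot> c (Suc m) = c (Suc m) \<cdot> D m k"
  using \<open>k \<le> m\<close>
proof (induction k)
  case 0
  then show ?case
    using c_in[OF \<open>Suc m \<le> n\<close>] by (simp add: Ident_left Ident_right del: up_prod.simps)
next
  case (Suc k)
  define i where "i = m - Suc k"
  have i: "Suc m - Suc k = Suc i" "m - Suc k = i"
    using Suc by (simp_all add: i_def)
  have [simp]: "\<tau> i \<in> Hom C a a" "\<tau> (Suc i) \<in> Hom C a a" "c (Suc m) \<in> Hom C a a"
      "D m k \<in> Hom C a a" "D (Suc m) k \<in> Hom C a a"
    using Suc i assms gen_in c_in[of "Suc m"] D_in by simp_all
  have "D (Suc m) (Suc k) \<cdot> c (Suc m) = D (Suc m) k \<cdot> \<tau> (Suc i) \<cdot> c (Suc m)"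
    by (simp add: i assoc del: up_prod.simps diff_Suc_Suc)
  also have "\<dots> = D (Suc m) k \<cdot> c (Suc m) \<cdot> \<tau> i"
    using gen_c[of i "Suc m"] Suc assms by (simp add: i_def del: up_prod.simps)
  also have "\<dots> = (D (Suc m) k \<cdot> c (Suc m)) \<cdot> \<tau> i"
    by (simp add: assoc del: up_prod.simps)
  also have "\<dots> = (c (Suc m) \<cdot> D m k) \<cdot> \<tau> i"
    using Suc by (simp del: up_prod.simps)
  also have "\<dots> = c (Suc m) \<cdot> D m (Suc k)"
    by (simp add: i assoc del: up_prod.simps(2))
  finally show ?case .
qed

lemma D_Suc_left:
  assumes "Suc m \<le> n" "k \<le> m"
  shows "D (Suc m) (Suc k) = \<tau> m \<cdot> D m k"
  using \<open>k \<le> m\<close>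
proof (induction k)
  case 0
  then show ?case
    using gen_in[of m] assms by (simp add: Ident_left Ident_right)
next
  case (Suc k)
  have [simp]: "\<tau> m \<in> Hom C a a" "\<tau> (m - Suc k) \<in> Hom C a a" "D m k \<in> Hom C a a"
    using Suc assms gen_in D_in by simp_all
  show ?case
    unfolding down_prod.simps(2)[of _ _ _ "Suc m" "Suc k"] using Suc
    by (simp add: assoc del: down_prod.simps(2)) (simp add: assoc)
qed

text \<open>Both products run over the same involutions, in opposite orders.\<close>

lemma c_D: "m \<le> n \<Longrightarrow> c m \<cdot> D m m = Ident C a"
proof (induction m)
  case 0
  then show ?case
    using Ident_left[OF id_in] by simp
next
  case (Suc m)
  have [simp]: "\<tau> m \<in> Hom C a a" "c m \<in> Hom C a a" "D m m \<in> Hom C a a"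
    using Suc gen_in c_in D_in by simp_all
  have "c (Suc m) \<cdot> D (Suc m) (Suc m) = c m \<cdot> (\<tau> m \<cdot> \<tau> m) \<cdot> D m m"
    using D_Suc_left[of m m] Suc.prems by (simp add: assoc endo_in del: down_prod.simps)
  also have "\<dots> = Ident C a"
    using Suc involution[of m] by (simp add: Ident_left[of _ a a])
  finally show ?case .
qed

text \<open>This reduces the powers of a cycle to those of the cycle that is shorter by one. Since
  \<open>c (Suc m) = c m \<cdot> \<tau> m\<close>, each further factor \<open>c (Suc m)\<close> slides to the left through the descending
  product, whose indices drop by one, and leaves there another factor \<open>c m\<close> and the new first factor
  \<open>\<tau> m\<close>.\<close>

lemma c_pow:
  assumes "Suc m \<le> n" "k \<le> Suc m"
  shows "arr_pow C (c (Suc m)) k = arr_pow C (c m) k \<cdot> D (Suc m) k"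
  using \<open>k \<le> Suc m\<close>
proof (induction k)
  case 0
  then show ?case
    using arr_pow_0[OF c_in[of m]] arr_pow_0[OF c_in[of "Suc m"]] assms Ident_left[OF id_in]
    by (simp del: arr_pow.simps up_prod.simps)
next
  case (Suc k)
  have [simp]: "\<tau> m \<in> Hom C a a" "c m \<in> Hom C a a" "c (Suc m) \<in> Hom C a a"
      "D m k \<in> Hom C a a" "D (Suc m) k \<in> Hom C a a"
    using Suc assms gen_in c_in[of m] c_in[of "Suc m"] D_in[of m k] D_in[of "Suc m" k]
    by simp_all
  have [simp]: "arr_pow C (c m) k \<in> Hom C a a"
    by (rule arr_pow_in) simp
  have "arr_pow C (c (Suc m)) (Suc k) = arr_pow C (c (Suc m)) k \<cdot> c (Suc m)"
    by (rule arr_pow_Suc_right[of _ a]) (simp del: up_prod.simps)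
  also have "\<dots> = arr_pow C (c m) k \<cdot> D (Suc m) k \<cdot> c (Suc m)"
    using Suc by (simp add: assoc del: up_prod.simps)
  also have "\<dots> = arr_pow C (c m) k \<cdot> c (Suc m) \<cdot> D m k"
    using D_c[of m k] Suc assms by (simp del: up_prod.simps)
  also have "\<dots> = (arr_pow C (c m) k \<cdot> c m) \<cdot> \<tau> m \<cdot> D m k"
    by (simp add: assoc endo_in)
  also have "\<dots> = arr_pow C (c m) (Suc k) \<cdot> D (Suc m) (Suc k)"
    using D_Suc_left[of m k] arr_pow_Suc_right[of "c m" a k] Suc assms
    by (simp del: down_prod.simps arr_pow.simps)
  finally show ?case .
qed

text \<open>By induction \<open>c m\<close> contributes nothing to the \<open>(m + 1)\<close>-st power of \<open>c (Suc m)\<close>, which is thus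
  the full descending product, the inverse of \<open>c (Suc m)\<close>.\<close>

theorem coxeter_element_order: "m \<le> n \<Longrightarrow> arr_pow C (c m) (Suc m) = Ident C a"
proof (induction m)
  case 0
  then show ?case
    using arr_pow_1[OF id_in] by (simp del: arr_pow.simps)
next
  case (Suc m)
  have "arr_pow C (c (Suc m)) (Suc m) = D (Suc m) (Suc m)"
    using Suc c_pow[of m "Suc m"] Ident_left[OF D_in[of "Suc m" "Suc m"]]
    by (simp del: arr_pow.simps up_prod.simps down_prod.simps)
  then show ?case
    using c_D[OF Suc.prems] arr_pow.simps(2) by metis
qed

end

section \<open>Cyclic objects\<close>

context simplicial_object
begin

text \<open>The relations with positive index and the cyclicity \<open>t\<^sub>n\<^bsup>n+1\<^esup> = 1\<close> suffice. The inverse of \<open>t\<^sub>n\<close> is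
  \<open>t\<^sub>n\<^bsup>n\<^esup>\<close>. Passing \<open>\<partial>\<^sub>n\<close> and \<open>\<sigma>\<^sub>n\<close> through it yields \<open>\<partial>\<^sub>n t\<^sub>n\<^bsup>-1\<^esup> = t\<^bsub>n-1\<^esub>\<^bsup>n\<^esup> \<partial>\<^sub>0 = \<partial>\<^sub>0\<close> and
  \<open>\<sigma>\<^sub>n t\<^sub>n\<^bsup>-1\<^esup> = t\<^bsub>n+1\<^esub>\<^bsup>n\<^esup> \<sigma>\<^sub>0 = t\<^bsub>n+1\<^esub>\<^bsup>-2\<^esup> \<sigma>\<^sub>0\<close>.\<close>

lemma cyclic_objectI:
  assumes t0: "t 0 = Ident C (X 0)"
    and t: "\<And>n. t n \<in> Hom C (X n) (X n)"
    and dt: "\<And>n i. n \<ge> 1 \<Longrightarrow> 0 < i \<Longrightarrow> i \<le> n \<Longrightarrow> d n i \<cdot> t n = t (n - 1) \<cdot> d n (i - 1)"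
    and st: "\<And>n i. n \<ge> 1 \<Longrightarrow> 0 < i \<Longrightarrow> i \<le> n \<Longrightarrow> s n i \<cdot> t n = t (n + 1) \<cdot> s n (i - 1)"
    and pow: "\<And>n. arr_pow C (t n) (n + 1) = Ident C (X n)"
  shows "cyclic_object C X d s t"
proof unfold_locales
  note p = arr_pow_in[OF t]
  have inv: "t n \<cdot> arr_pow C (t n) n = Ident C (X n)"
      "arr_pow C (t n) n \<cdot> t n = Ident C (X n)" for n
    using pow[of n] arr_pow_Suc_right[OF t, of n n] by simp_all
  show "t n \<in> iso_in C (X n) (X n)" for n
    unfolding iso_in_def using t p inv by blast
  show "d n 0 \<cdot> t n = d n n" if "n \<ge> 1" for n
  proof -
    obtain m where n: "n = Suc m"
      using \<open>n \<ge> 1\<close> by (cases n) auto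
    have d: "d n i \<in> Hom C (X n) (X m)" if "i \<le> n" for i
      using d_in that n by simp
    have slide: "d n n \<cdot> arr_pow C (t n) n = arr_pow C (t m) n \<cdot> d n 0"
      using slide_power[where f="d n", OF d t t, of n n] dt n by simp
    have "d n n = (d n n \<cdot> arr_pow C (t n) n) \<cdot> t n"
      using Compose_assoc[OF t p d] inv(2) Ident_right[OF d] by simp
    also have "\<dots> = d n 0 \<cdot> t n"
      using slide pow[of m] n Ident_left[OF d[of 0]] by simp
    finally show ?thesis
      by simp
  qed
  show "s n 0 \<cdot> t n = arr_pow C (t (n + 1)) 2 \<cdot> s n n" if "n \<ge> 1" for n
  proof -
    let ?u = "arr_pow C (t (Suc n))"
    have s: "s n i \<in> Hom C (X n) (X (Suc n))" if "i \<le> n" for i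
      using s_in that .
    have slide: "s n n \<cdot> arr_pow C (t n) n = ?u n \<cdot> s n 0"
      using slide_power[where f="s n", OF s t t, of n n] st that by simp
    have u: "?u 2 \<cdot> ?u n = Ident C (X (Suc n))"
      using arr_pow_add[OF t, of "Suc n" 2 n] pow[of "Suc n"] by simp
    have "?u 2 \<cdot> s n n = ?u 2 \<cdot> (s n n \<cdot> arr_pow C (t n) n) \<cdot> t n"
      using Compose_assoc[OF t p s] inv(2) Ident_right[OF s] by simp
    also have "\<dots> = ?u 2 \<cdot> ?u n \<cdot> s n 0 \<cdot> t n"
      using slide Compose_assoc[OF t s p] by simp
    also have "\<dots> = (?u 2 \<cdot> ?u n) \<cdot> s n 0 \<cdot> t n"
      using Compose_assoc[OF Compose_in[OF t s] p p] by simp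
    also have "\<dots> = s n 0 \<cdot> t n"
      unfolding u using Ident_left[OF Compose_in[OF t s]] by simp
    finally show ?thesis
      by simp
  qed
qed (use t0 dt st pow in auto)

end

section \<open>Functor categories\<close>

lemma comp_fctr_is_functor:
  assumes "is_functor A B F" "is_functor B D H"
  shows "is_functor A D (comp_fctr A H F)"
proof -
  interpret F: is_functor A B F by fact
  interpret H: is_functor B D H by fact
  show ?thesis
  proof
    show "FArr (comp_fctr A H F) (g \<cdot>\<^bsub>A\<^esub> f) = FArr (comp_fctr A H F) g \<cdot>\<^bsub>D\<^esub> FArr (comp_fctr A H F) f"
      if "f \<in> Hom A a b" "g \<in> Hom A b c" for f g a b c
      using F.A.Compose_in[OF that] that F.A.Hom_Arr F.FArr_in H.FArr_Compose
      by (simp add: comp_fctr_def F.FArr_Compose[OF that])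
        (metis F.A.Hom_Arr F.FArr_in H.FArr_Compose that)
    show "FArr (comp_fctr A H F) f \<in> Hom D (FObj (comp_fctr A H F) a) (FObj (comp_fctr A H F) b)"
      if "f \<in> Hom A a b" for f a b
      using that F.A.Hom_Arr[OF that] F.A.Hom_Obj[OF that] F.FArr_in[OF that] H.FArr_in
      by (simp add: comp_fctr_def)
    show "FArr (comp_fctr A H F) (Ident A a) = Ident D (FObj (comp_fctr A H F) a)"
      if "a \<in> Obj A" for a
      using that F.A.Ident_in[OF that] F.A.Hom_Arr F.FObj_in
      by (simp add: comp_fctr_def F.FArr_Ident H.FArr_Ident)
  qed (auto simp: comp_fctr_def F.FObj_in H.FObj_in)
qed

lemma id_fctr_is_functor:
  assumes "category A"
  shows "is_functor A A (id_fctr A)"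
proof -
  interpret category A by fact
  show ?thesis
  proof
    show "FArr (id_fctr A) (g \<cdot>\<^bsub>A\<^esub> f) = FArr (id_fctr A) g \<cdot>\<^bsub>A\<^esub> FArr (id_fctr A) f"
      if "f \<in> Hom A a b" "g \<in> Hom A b c" for f g a b c
      using Compose_in[OF that] that Hom_Arr by (simp add: id_fctr_def)
    show "FArr (id_fctr A) f \<in> Hom A (FObj (id_fctr A) a) (FObj (id_fctr A) b)"
      if "f \<in> Hom A a b" for f a b
      using that Hom_Arr[OF that] Hom_Obj[OF that] by (simp add: id_fctr_def)
    show "FArr (id_fctr A) (Ident A a) = Ident A (FObj (id_fctr A) a)" if "a \<in> Obj A" for a
      using that Hom_Arr[OF Ident_in[OF that]] by (simp add: id_fctr_def)
  qed (auto simp: id_fctr_def)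
qed

lemma fctr_eqI:
  fixes F H :: "('o, 'm, 'p, 'q) fctr"
  assumes "is_functor A B F" "is_functor A B H"
    and "\<And>a. a \<in> Obj A \<Longrightarrow> FObj F a = FObj H a"
    and "\<And>f. f \<in> Arr A \<Longrightarrow> FArr F f = FArr H f"
  shows "F = H"
proof -
  have "FObj F = FObj H"
    using assms is_functor.FObj_ext extensionalityI by metis
  moreover have "FArr F = FArr H"
    using assms is_functor.FArr_ext extensionalityI by metis
  ultimately show ?thesis
    by simp
qed

lemma (in is_functor) FArr_Arr: "f \<in> Arr A \<Longrightarrow> FArr F f \<in> Arr B"
  using FArr_in[of f "Src A f" "Tgt A f"] by (simp add: Hom_def)

lemma comp_fctr_assoc:
  assumes "is_functor A B F"
  shows "comp_fctr A (comp_fctr B K H) F = comp_fctr A K (comp_fctr A H F)"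
proof -
  interpret F: is_functor A B F by fact
  show ?thesis
    by (auto simp: comp_fctr_def F.FObj_in F.FArr_Arr cong: restrict_cong)
qed

lemma comp_fctr_id_right:
  assumes "is_functor A B F"
  shows "comp_fctr A F (id_fctr A) = F"
proof -
  interpret F: is_functor A B F by fact
  show ?thesis
    by (rule fctr_eqI[OF comp_fctr_is_functor[OF id_fctr_is_functor assms] assms])
      (simp_all add: comp_fctr_def id_fctr_def F.A.category_axioms)
qed

lemma comp_fctr_id_left:
  assumes "is_functor A B F"
  shows "comp_fctr A (id_fctr B) F = F"
proof -
  interpret F: is_functor A B F by fact
  show ?thesis
    by (rule fctr_eqI[OF comp_fctr_is_functor[OF assms id_fctr_is_functor] assms])
      (auto simp: comp_fctr_def id_fctr_def F.FObj_in F.FArr_Arr F.B.category_axioms)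
qed

lemma Hom_fctr_cat:
  "\<tau> \<in> Hom (fctr_cat A B) F H \<longleftrightarrow> is_ntrans A B \<tau> \<and> NSrc \<tau> = F \<and> NTgt \<tau> = H"
  by (simp add: Hom_def fctr_cat_def)

lemma Obj_fctr_cat: "F \<in> Obj (fctr_cat A B) \<longleftrightarrow> is_functor A B F"
  by (simp add: fctr_cat_def)

lemma Cpt_Ident: "a \<in> Obj A \<Longrightarrow> Cpt (Ident (fctr_cat A B) F) a = Ident B (FObj F a)"
  by (simp add: fctr_cat_def)

lemma Cpt_Compose: "a \<in> Obj A \<Longrightarrow> Cpt (\<tau> \<cdot>\<^bsub>fctr_cat A B\<^esub> \<rho>) a = Cpt \<tau> a \<cdot>\<^bsub>B\<^esub> Cpt \<rho> a"
  by (simp add: fctr_cat_def)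

text \<open>Values of \<open>c\<close> off the objects of \<open>A\<close> are arbitrary, so that the components of composites and
  whiskerings can be given by their plain formulas.\<close>

lemma ntransI:
  assumes "is_functor A B F" "is_functor A B H"
    and "\<And>a. a \<in> Obj A \<Longrightarrow> c a \<in> Hom B (FObj F a) (FObj H a)"
    and "\<And>f a b. f \<in> Hom A a b \<Longrightarrow> c b \<cdot>\<^bsub>B\<^esub> FArr F f = FArr H f \<cdot>\<^bsub>B\<^esub> c a"
  shows "is_ntrans A B \<lparr>NSrc = F, NTgt = H, Cpt = restrict c (Obj A)\<rparr>"
proof -
  interpret F: is_functor A B F by fact
  interpret H: is_functor A B H by fact
  show ?thesis
  proof
    show "Cpt \<lparr>NSrc = F, NTgt = H, Cpt = restrict c (Obj A)\<rparr> b \<cdot>\<^bsub>B\<^esub>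
        FArr (NSrc \<lparr>NSrc = F, NTgt = H, Cpt = restrict c (Obj A)\<rparr>) f =
        FArr (NTgt \<lparr>NSrc = F, NTgt = H, Cpt = restrict c (Obj A)\<rparr>) f \<cdot>\<^bsub>B\<^esub>
        Cpt \<lparr>NSrc = F, NTgt = H, Cpt = restrict c (Obj A)\<rparr> a"
      if "f \<in> Hom A a b" for f a b
      using F.A.Hom_Obj[OF that] assms(4)[OF that] by simp
  qed (simp_all add: assms F.FObj_ext F.FArr_ext F.FObj_in F.FArr_in F.FArr_Ident F.FArr_Compose
      H.FObj_ext H.FArr_ext H.FObj_in H.FArr_in H.FArr_Ident H.FArr_Compose)
qed

lemma ntrans_eqI:
  assumes \<tau>: "\<tau> \<in> Hom (fctr_cat A B) F H" and \<rho>: "\<rho> \<in> Hom (fctr_cat A B) F H"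
    and eq: "\<And>a. a \<in> Obj A \<Longrightarrow> Cpt \<tau> a = Cpt \<rho> a"
  shows "\<tau> = \<rho>"
proof -
  have "Cpt \<tau> = Cpt \<rho>"
    using assms is_ntrans.Cpt_ext extensionalityI unfolding Hom_fctr_cat by metis
  then show ?thesis
    using \<tau> \<rho> by (simp add: Hom_fctr_cat)
qed

lemma Cpt_Hom:
  assumes "\<tau> \<in> Hom (fctr_cat A B) F H" "a \<in> Obj A"
  shows "Cpt \<tau> a \<in> Hom B (FObj F a) (FObj H a)"
  using assms is_ntrans.Cpt_in unfolding Hom_fctr_cat by metis

lemma Cpt_natural:
  assumes "\<tau> \<in> Hom (fctr_cat A B) F H" "f \<in> Hom A a b"
  shows "Cpt \<tau> b \<cdot>\<^bsub>B\<^esub> FArr F f = FArr H f \<cdot>\<^bsub>B\<^esub> Cpt \<tau> a"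
  using assms is_ntrans.naturality unfolding Hom_fctr_cat by metis

lemma fctr_cat_functors:
  assumes "\<tau> \<in> Hom (fctr_cat A B) F H"
  shows "is_functor A B F" "is_functor A B H"
  using assms is_ntrans.axioms unfolding Hom_fctr_cat by metis+

lemma fctr_cat_is_category:
  fixes A :: "('o, 'm) cat" and B :: "('p, 'q) cat"
  assumes "category A" "category B"
  shows "category (fctr_cat A B)"
proof -
  interpret A: category A by fact
  interpret B: category B by fact
  have id: "Ident (fctr_cat A B) F \<in> Hom (fctr_cat A B) F F"
    if "F \<in> Obj (fctr_cat A B)" for F
  proof -
    interpret F: is_functor A B F
      using that by (simp add: Obj_fctr_cat)
    have "is_ntrans A B (Ident (fctr_cat A B) F)"
      unfolding fctr_cat_def cat.simps
    proof (intro ntransI F.is_functor_axioms)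
      show "Ident B (FObj F b) \<cdot>\<^bsub>B\<^esub> FArr F f = FArr F f \<cdot>\<^bsub>B\<^esub> Ident B (FObj F a)"
        if "f \<in> Hom A a b" for f a b
        using F.FArr_in[OF that] by (simp add: B.Ident_left B.Ident_right)
    qed (simp add: B.Ident_in F.FObj_in)
    then show ?thesis
      by (simp add: Hom_fctr_cat) (simp add: fctr_cat_def)
  qed
  have comp: "\<sigma> \<cdot>\<^bsub>fctr_cat A B\<^esub> \<tau> \<in> Hom (fctr_cat A B) F K"
    if \<tau>: "\<tau> \<in> Hom (fctr_cat A B) F H" and \<sigma>: "\<sigma> \<in> Hom (fctr_cat A B) H K" for \<sigma> \<tau> F H K
  proof -
    note c = Cpt_Hom[OF \<tau>] Cpt_Hom[OF \<sigma>]
    have src: "NSrc \<tau> = F" "NTgt \<sigma> = K"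
      using \<tau> \<sigma> by (simp_all add: Hom_fctr_cat)
    have "is_ntrans A B (\<sigma> \<cdot>\<^bsub>fctr_cat A B\<^esub> \<tau>)"
      unfolding fctr_cat_def cat.simps src
    proof (rule ntransI)
      show "is_functor A B F" "is_functor A B K"
        using \<tau> \<sigma> fctr_cat_functors by blast+
      show "Cpt \<sigma> a \<cdot>\<^bsub>B\<^esub> Cpt \<tau> a \<in> Hom B (FObj F a) (FObj K a)" if "a \<in> Obj A" for a
        using B.Compose_in c that by blast
      show "(Cpt \<sigma> b \<cdot>\<^bsub>B\<^esub> Cpt \<tau> b) \<cdot>\<^bsub>B\<^esub> FArr F f = FArr K f \<cdot>\<^bsub>B\<^esub> (Cpt \<sigma> a \<cdot>\<^bsub>B\<^esub> Cpt \<tau> a)"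
        if f: "f \<in> Hom A a b" for f a b
      proof -
        have ab: "a \<in> Obj A" "b \<in> Obj A"
          using A.Hom_Obj f by auto
        note Fs = fctr_cat_functors[OF \<tau>] fctr_cat_functors[OF \<sigma>]
        note Ff = is_functor.FArr_in[OF Fs(1) f] is_functor.FArr_in[OF Fs(2) f]
          is_functor.FArr_in[OF Fs(4) f]
        have "(Cpt \<sigma> b \<cdot>\<^bsub>B\<^esub> Cpt \<tau> b) \<cdot>\<^bsub>B\<^esub> FArr F f = Cpt \<sigma> b \<cdot>\<^bsub>B\<^esub> (Cpt \<tau> b \<cdot>\<^bsub>B\<^esub> FArr F f)"
          using B.Compose_assoc[OF Ff(1) c(1) c(2)] ab by simp
        also have "\<dots> = (Cpt \<sigma> b \<cdot>\<^bsub>B\<^esub> FArr H f) \<cdot>\<^bsub>B\<^esub> Cpt \<tau> a"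
          using B.Compose_assoc[OF c(1) Ff(2) c(2)] ab Cpt_natural[OF \<tau> f] by simp
        also have "\<dots> = FArr K f \<cdot>\<^bsub>B\<^esub> (Cpt \<sigma> a \<cdot>\<^bsub>B\<^esub> Cpt \<tau> a)"
          using B.Compose_assoc[OF c(1) c(2) Ff(3)] ab Cpt_natural[OF \<sigma> f] by simp
        finally show ?thesis .
      qed
    qed
    then show ?thesis
      using src by (simp add: Hom_fctr_cat) (simp add: fctr_cat_def)
  qed
  show ?thesis
  proof
    show "Src (fctr_cat A B) f \<in> Obj (fctr_cat A B)" "Tgt (fctr_cat A B) f \<in> Obj (fctr_cat A B)"
      if "f \<in> Arr (fctr_cat A B)" for f
      using that by (simp_all add: fctr_cat_def is_ntrans_def)
    show "\<tau> \<cdot>\<^bsub>fctr_cat A B\<^esub> Ident (fctr_cat A B) F = \<tau>"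
      if \<tau>: "\<tau> \<in> Hom (fctr_cat A B) F H" for \<tau> F H
    proof (rule ntrans_eqI[OF comp[OF id \<tau>] \<tau>])
      show "F \<in> Obj (fctr_cat A B)"
        using fctr_cat_functors[OF \<tau>] by (simp add: Obj_fctr_cat)
      show "Cpt (\<tau> \<cdot>\<^bsub>fctr_cat A B\<^esub> Ident (fctr_cat A B) F) a = Cpt \<tau> a" if "a \<in> Obj A" for a
        using B.Ident_right[OF Cpt_Hom[OF \<tau> that]] that by (simp add: Cpt_Compose Cpt_Ident)
    qed
    show "Ident (fctr_cat A B) H \<cdot>\<^bsub>fctr_cat A B\<^esub> \<tau> = \<tau>"
      if \<tau>: "\<tau> \<in> Hom (fctr_cat A B) F H" for \<tau> F H
    proof (rule ntrans_eqI[OF comp[OF \<tau> id] \<tau>])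
      show "H \<in> Obj (fctr_cat A B)"
        using fctr_cat_functors[OF \<tau>] by (simp add: Obj_fctr_cat)
      show "Cpt (Ident (fctr_cat A B) H \<cdot>\<^bsub>fctr_cat A B\<^esub> \<tau>) a = Cpt \<tau> a" if "a \<in> Obj A" for a
        using B.Ident_left[OF Cpt_Hom[OF \<tau> that]] that by (simp add: Cpt_Compose Cpt_Ident)
    qed
    show "(\<rho> \<cdot>\<^bsub>fctr_cat A B\<^esub> \<sigma>) \<cdot>\<^bsub>fctr_cat A B\<^esub> \<tau> = \<rho> \<cdot>\<^bsub>fctr_cat A B\<^esub> (\<sigma> \<cdot>\<^bsub>fctr_cat A B\<^esub> \<tau>)"
      if \<tau>: "\<tau> \<in> Hom (fctr_cat A B) F H" and \<sigma>: "\<sigma> \<in> Hom (fctr_cat A B) H K"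
        and \<rho>: "\<rho> \<in> Hom (fctr_cat A B) K L" for \<tau> \<sigma> \<rho> F H K L
    proof (rule ntrans_eqI[OF comp[OF \<tau> comp[OF \<sigma> \<rho>]] comp[OF comp[OF \<tau> \<sigma>] \<rho>]])
      show "Cpt ((\<rho> \<cdot>\<^bsub>fctr_cat A B\<^esub> \<sigma>) \<cdot>\<^bsub>fctr_cat A B\<^esub> \<tau>) a =
          Cpt (\<rho> \<cdot>\<^bsub>fctr_cat A B\<^esub> (\<sigma> \<cdot>\<^bsub>fctr_cat A B\<^esub> \<tau>)) a" if "a \<in> Obj A" for a
        using B.Compose_assoc[OF Cpt_Hom[OF \<tau> that] Cpt_Hom[OF \<sigma> that] Cpt_Hom[OF \<rho> that]] that
        by (simp add: Cpt_Compose)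
    qed
  qed (use id comp in auto)
qed

section \<open>Whiskering\<close>

lemma Cpt_whisker: "a \<in> Obj A \<Longrightarrow> Cpt (whisker A H \<tau> F) a = FArr H (Cpt \<tau> (FObj F a))"
  by (simp add: whisker_def)

lemma whisker_in:
  assumes \<tau>: "\<tau> \<in> Hom (fctr_cat B D) K K'" and F: "is_functor A B F" and H: "is_functor D E H"
  shows "whisker A H \<tau> F \<in>
    Hom (fctr_cat A E) (comp_fctr A H (comp_fctr A K F)) (comp_fctr A H (comp_fctr A K' F))"
proof -
  interpret F: is_functor A B F by fact
  interpret H: is_functor D E H by fact
  interpret K: is_functor B D K using fctr_cat_functors[OF \<tau>] by simp
  interpret K': is_functor B D K' using fctr_cat_functors[OF \<tau>] by simp
  have src: "NSrc \<tau> = K" "NTgt \<tau> = K'"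
    using \<tau> by (simp_all add: Hom_fctr_cat)
  have "is_ntrans A E (whisker A H \<tau> F)"
    unfolding whisker_def src
  proof (intro ntransI comp_fctr_is_functor)
    show "is_functor A B F" "is_functor A B F" "is_functor B D K" "is_functor B D K'"
      "is_functor D E H" "is_functor D E H" by unfold_locales
    show "FArr H (Cpt \<tau> (FObj F a)) \<in>
        Hom E (FObj (comp_fctr A H (comp_fctr A K F)) a) (FObj (comp_fctr A H (comp_fctr A K' F)) a)"
      if "a \<in> Obj A" for a
      using that H.FArr_in[OF Cpt_Hom[OF \<tau> F.FObj_in]] by (simp add: comp_fctr_def)
    show "FArr H (Cpt \<tau> (FObj F b)) \<cdot>\<^bsub>E\<^esub> FArr (comp_fctr A H (comp_fctr A K F)) f =
        FArr (comp_fctr A H (comp_fctr A K' F)) f \<cdot>\<^bsub>E\<^esub> FArr H (Cpt \<tau> (FObj F a))"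
      if f: "f \<in> Hom A a b" for f a b
    proof -
      have "a \<in> Obj A" "b \<in> Obj A" "f \<in> Arr A"
        using F.A.Hom_Obj[OF f] F.A.Hom_Arr[OF f] by auto
      then show ?thesis
        using Cpt_natural[OF \<tau> F.FArr_in[OF f]]
          H.FArr_Compose[OF K.FArr_in[OF F.FArr_in[OF f]] Cpt_Hom[OF \<tau> F.FObj_in]]
          H.FArr_Compose[OF Cpt_Hom[OF \<tau> F.FObj_in] K'.FArr_in[OF F.FArr_in[OF f]]]
        by (simp add: comp_fctr_def)
    qed
  qed
  then show ?thesis
    by (simp add: Hom_fctr_cat src) (simp add: whisker_def src)
qed

lemma whisker_Compose:
  assumes \<tau>: "\<tau> \<in> Hom (fctr_cat B D) K K'" and \<sigma>: "\<sigma> \<in> Hom (fctr_cat B D) K' K''"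
    and F: "is_functor A B F" and H: "is_functor D E H"
  shows "whisker A H (\<sigma> \<cdot>\<^bsub>fctr_cat B D\<^esub> \<tau>) F = whisker A H \<sigma> F \<cdot>\<^bsub>fctr_cat A E\<^esub> whisker A H \<tau> F"
proof -
  interpret F: is_functor A B F by fact
  interpret H: is_functor D E H by fact
  interpret K: is_functor B D K using fctr_cat_functors[OF \<tau>] by simp
  interpret BD: category "fctr_cat B D"
    using fctr_cat_is_category F.B.category_axioms H.A.category_axioms .
  interpret AE: category "fctr_cat A E"
    using fctr_cat_is_category F.A.category_axioms H.B.category_axioms .
  show ?thesis
  proof (rule ntrans_eqI)
    show "whisker A H (\<sigma> \<cdot>\<^bsub>fctr_cat B D\<^esub> \<tau>) F \<in>
        Hom (fctr_cat A E) (comp_fctr A H (comp_fctr A K F)) (comp_fctr A H (comp_fctr A K'' F))"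
      using whisker_in[OF BD.Compose_in[OF \<tau> \<sigma>] F H] .
    show "whisker A H \<sigma> F \<cdot>\<^bsub>fctr_cat A E\<^esub> whisker A H \<tau> F \<in>
        Hom (fctr_cat A E) (comp_fctr A H (comp_fctr A K F)) (comp_fctr A H (comp_fctr A K'' F))"
      using AE.Compose_in[OF whisker_in[OF \<tau> F H] whisker_in[OF \<sigma> F H]] .
    show "Cpt (whisker A H (\<sigma> \<cdot>\<^bsub>fctr_cat B D\<^esub> \<tau>) F) a =
        Cpt (whisker A H \<sigma> F \<cdot>\<^bsub>fctr_cat A E\<^esub> whisker A H \<tau> F) a" if "a \<in> Obj A" for a
      using that H.FArr_Compose[OF Cpt_Hom[OF \<tau> F.FObj_in] Cpt_Hom[OF \<sigma> F.FObj_in]]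
      by (simp add: Cpt_whisker Cpt_Compose F.FObj_in)
  qed
qed

lemma whisker_Ident:
  assumes F: "is_functor A B F" and K: "is_functor B D K" and H: "is_functor D E H"
  shows "whisker A H (Ident (fctr_cat B D) K) F =
    Ident (fctr_cat A E) (comp_fctr A H (comp_fctr A K F))"
proof -
  interpret F: is_functor A B F by fact
  interpret K: is_functor B D K by fact
  interpret H: is_functor D E H by fact
  show ?thesis
    by (auto simp: whisker_def fctr_cat_def comp_fctr_def F.FObj_in K.FObj_in H.FArr_Ident
        cong: restrict_cong)
qed

lemma whisker_whisker:
  assumes \<tau>: "\<tau> \<in> Hom (fctr_cat P Q) K K'"
    and F: "is_functor A B F" and F': "is_functor B P F'" and H': "is_functor Q R H'"
  shows "whisker A H (whisker B H' \<tau> F') F = whisker A (comp_fctr Q H H') \<tau> (comp_fctr A F' F)"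
proof -
  interpret F: is_functor A B F by fact
  interpret F': is_functor B P F' by fact
  note Ks = fctr_cat_functors[OF \<tau>]
  have src: "NSrc \<tau> = K" "NTgt \<tau> = K'"
    using \<tau> by (simp_all add: Hom_fctr_cat)
  have "Cpt \<tau> a \<in> Arr Q" if "a \<in> Obj P" for a
    using Cpt_Hom[OF \<tau> that] by (simp add: Hom_def)
  moreover have "comp_fctr A (comp_fctr Q H H') (comp_fctr A L (comp_fctr A F' F)) =
      comp_fctr A H (comp_fctr A (comp_fctr B H' (comp_fctr B L F')) F)"
    if L: "is_functor P Q L" for L
    by (simp add: comp_fctr_assoc[OF F] comp_fctr_assoc[OF comp_fctr_is_functor[OF F F']]
        comp_fctr_assoc[OF comp_fctr_is_functor[OF comp_fctr_is_functor[OF F F'] L]])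
  ultimately show ?thesis
    using Ks
    by (auto simp: whisker_def src comp_fctr_def[of Q] comp_fctr_def[of A F' F]
        F.FObj_in F'.FObj_in cong: restrict_cong)
qed

lemma whisker_id:
  assumes \<tau>: "\<tau> \<in> Hom (fctr_cat A B) K K'"
  shows "whisker A (id_fctr B) \<tau> (id_fctr A) = \<tau>"
proof (rule ntrans_eqI[OF _ \<tau>])
  note Ks = fctr_cat_functors[OF \<tau>]
  interpret K: is_functor A B K using Ks by simp
  show "whisker A (id_fctr B) \<tau> (id_fctr A) \<in> Hom (fctr_cat A B) K K'"
    using whisker_in[OF \<tau> id_fctr_is_functor id_fctr_is_functor] Ks
    by (simp add: comp_fctr_id_left comp_fctr_id_right K.A.category_axioms K.B.category_axioms)
  show "Cpt (whisker A (id_fctr B) \<tau> (id_fctr A)) a = Cpt \<tau> a" if "a \<in> Obj A" for a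
    using that K.B.Hom_Arr[OF Cpt_Hom[OF \<tau> that]] by (simp add: Cpt_whisker) (simp add: id_fctr_def)
qed

text \<open>The interchange law is the naturality of \<open>\<alpha>\<close> at the components of \<open>\<beta>\<close>.\<close>

lemma whisker_interchange:
  assumes \<alpha>: "\<alpha> \<in> Hom (fctr_cat B D) F F'" and \<beta>: "\<beta> \<in> Hom (fctr_cat A B) K K'"
  shows "whisker A (id_fctr D) \<alpha> K' \<cdot>\<^bsub>fctr_cat A D\<^esub> whisker A F \<beta> (id_fctr A) =
    whisker A F' \<beta> (id_fctr A) \<cdot>\<^bsub>fctr_cat A D\<^esub> whisker A (id_fctr D) \<alpha> K"
proof -
  note Fs = fctr_cat_functors[OF \<alpha>] and Ks = fctr_cat_functors[OF \<beta>]
  interpret F: is_functor B D F using Fs by simp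
  interpret K: is_functor A B K using Ks by simp
  interpret K': is_functor A B K' using Ks by simp
  interpret AD: category "fctr_cat A D"
    using fctr_cat_is_category K.A.category_axioms F.B.category_axioms .
  note idA = id_fctr_is_functor[OF K.A.category_axioms]
  note idD = id_fctr_is_functor[OF F.B.category_axioms]
  have \<alpha>K: "whisker A (id_fctr D) \<alpha> L \<in> Hom (fctr_cat A D) (comp_fctr A F L) (comp_fctr A F' L)"
    if "is_functor A B L" for L
    using whisker_in[OF \<alpha> that idD] Fs that
    by (simp add: comp_fctr_id_left[OF comp_fctr_is_functor])
  have F\<beta>: "whisker A L \<beta> (id_fctr A) \<in> Hom (fctr_cat A D) (comp_fctr A L K) (comp_fctr A L K')"
    if "is_functor B D L" for L
    using whisker_in[OF \<beta> idA that] Ks by (simp add: comp_fctr_id_right)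
  show ?thesis
  proof (rule ntrans_eqI)
    show "whisker A (id_fctr D) \<alpha> K' \<cdot>\<^bsub>fctr_cat A D\<^esub> whisker A F \<beta> (id_fctr A) \<in>
        Hom (fctr_cat A D) (comp_fctr A F K) (comp_fctr A F' K')"
      using AD.Compose_in \<alpha>K F\<beta> Fs Ks by blast
    show "whisker A F' \<beta> (id_fctr A) \<cdot>\<^bsub>fctr_cat A D\<^esub> whisker A (id_fctr D) \<alpha> K \<in>
        Hom (fctr_cat A D) (comp_fctr A F K) (comp_fctr A F' K')"
      using AD.Compose_in \<alpha>K F\<beta> Fs Ks by blast
    fix a assume a: "a \<in> Obj A"
    have idD': "FArr (id_fctr D) (Cpt \<alpha> b) = Cpt \<alpha> b" if "b \<in> Obj B" for b
      using F.B.Hom_Arr[OF Cpt_Hom[OF \<alpha> that]] by (simp add: id_fctr_def)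
    have ida: "FObj (id_fctr A) a = a"
      using a by (simp add: id_fctr_def)
    show "Cpt (whisker A (id_fctr D) \<alpha> K' \<cdot>\<^bsub>fctr_cat A D\<^esub> whisker A F \<beta> (id_fctr A)) a =
        Cpt (whisker A F' \<beta> (id_fctr A) \<cdot>\<^bsub>fctr_cat A D\<^esub> whisker A (id_fctr D) \<alpha> K) a"
      using Cpt_natural[OF \<alpha> Cpt_Hom[OF \<beta> a]] a
      by (simp add: Cpt_Compose Cpt_whisker idD' ida K.FObj_in K'.FObj_in)
  qed
qed

section \<open>Powers of an endofunctor\<close>

(* Powers stay folded, so that equations between them are arithmetic of exponents. *)
declare fctr_pow.simps [simp del]

locale endofunctor = is_functor A A G
  for A :: "('o, 'm) cat" (structure) and G :: "('o, 'm, 'o, 'm) fctr"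
begin

sublocale E: category "End_cat A"
  by (intro fctr_cat_is_category A.category_axioms)

abbreviation vcomp (infixr "\<bullet>" 70) where
  "\<tau> \<bullet> \<sigma> \<equiv> \<tau> \<cdot>\<^bsub>End_cat A\<^esub> \<sigma>"

abbreviation P :: "nat \<Rightarrow> ('o, 'm, 'o, 'm) fctr" where
  "P \<equiv> fctr_pow A G"

text \<open>Think of \<open>G\<^sup>n\<close> as \<open>n\<close> parallel strands, numbered from the outermost functor. Then \<open>place i \<alpha> j\<close>
  is \<open>\<alpha>\<close> with \<open>i\<close> strands before it and \<open>j\<close> strands after it. The faces, the
  degeneracies and the factors of \<open>t\<^sub>n\<close> are of this kind.\<close>

abbreviation place ::
  "nat \<Rightarrow> ('o, 'm, 'o, 'm) ntrans \<Rightarrow> nat \<Rightarrow> ('o, 'm, 'o, 'm) ntrans" where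
  "place i \<alpha> j \<equiv> whisker A (P i) \<alpha> (P j)"

lemma pow_functor: "is_functor A A (P k)"
  by (induction k)
    (simp_all add: fctr_pow.simps id_fctr_is_functor comp_fctr_is_functor A.category_axioms is_functor_axioms)

lemma pow_Obj: "P k \<in> Obj (End_cat A)"
  using pow_functor by (simp add: Obj_fctr_cat)

lemma pow_1: "P (Suc 0) = G"
  by (simp add: fctr_pow.simps comp_fctr_id_right[OF is_functor_axioms])

lemma pow_2: "P (Suc (Suc 0)) = comp_fctr A G G"
  by (simp add: fctr_pow.simps comp_fctr_id_right[OF is_functor_axioms])

lemma pow_add: "comp_fctr A (P i) (P j) = P (i + j)"
  by (induction i) (simp_all add: fctr_pow.simps comp_fctr_id_left pow_functor comp_fctr_assoc[OF pow_functor])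

lemma place_in:
  assumes "\<alpha> \<in> Hom (End_cat A) (P p) (P q)" "m = i + p + j" "n = i + q + j"
  shows "place i \<alpha> j \<in> Hom (End_cat A) (P m) (P n)"
  using whisker_in[OF assms(1) pow_functor pow_functor, of i j] assms(2,3)
  by (simp add: pow_add add.assoc)

lemma place_Compose:
  assumes "\<alpha> \<in> Hom (End_cat A) (P p) (P q)" "\<beta> \<in> Hom (End_cat A) (P q) (P r)"
  shows "place i (\<beta> \<bullet> \<alpha>) j = place i \<beta> j \<bullet> place i \<alpha> j"
  using whisker_Compose[OF assms pow_functor pow_functor] .

lemma place_Ident: "place i (Ident (End_cat A) (P p)) j = Ident (End_cat A) (P (i + p + j))"
  using whisker_Ident[OF pow_functor pow_functor pow_functor, of i p j]
  by (simp add: pow_add add.assoc)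

lemma place_place:
  assumes "\<alpha> \<in> Hom (End_cat A) (P p) (P q)"
  shows "place i (place k \<alpha> l) j = place (i + k) \<alpha> (l + j)"
  using whisker_whisker[OF assms pow_functor pow_functor pow_functor, of "P i"]
  by (simp add: pow_add)

lemma place_0:
  assumes "\<alpha> \<in> Hom (End_cat A) (P p) (P q)"
  shows "place 0 \<alpha> 0 = \<alpha>"
  using whisker_id[OF assms] by (simp add: fctr_pow.simps)

text \<open>Operations on disjoint strands commute; \<open>k\<close> strands lie between those of \<open>\<alpha>\<close> and those of \<open>\<beta>\<close>.
  The shift from \<open>m\<close> to \<open>m'\<close> accounts for the number of strands that \<open>\<alpha>\<close> creates or removes. The
  positions occur in varied arithmetical forms and are therefore given by equations.\<close>

lemma place_interchange:
  assumes \<alpha>: "\<alpha> \<in> Hom (End_cat A) (P p) (P q)" and \<beta>: "\<beta> \<in> Hom (End_cat A) (P r) (P s)"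
    and idx: "m = i + p + k" "m' = i + q + k" "u = k + s + j" "v = k + r + j" "w = j"
  shows "place i \<alpha> u \<bullet> place m \<beta> j = place m' \<beta> w \<bullet> place i \<alpha> v"
proof -
  have \<beta>k: "place k \<beta> 0 \<in> Hom (End_cat A) (P (k + r)) (P (k + s))"
    by (rule place_in[OF \<beta>]) simp_all
  have "place 0 \<alpha> (k + s) \<bullet> place p (place k \<beta> 0) 0 =
      place q (place k \<beta> 0) 0 \<bullet> place 0 \<alpha> (k + r)"
    using whisker_interchange[OF \<alpha> \<beta>k] by (simp add: fctr_pow.simps)
  then have eq: "place 0 \<alpha> (k + s) \<bullet> place (p + k) \<beta> 0 = place (q + k) \<beta> 0 \<bullet> place 0 \<alpha> (k + r)"
    by (simp only: place_place[OF \<beta>] add_0)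
  have \<alpha>r: "place 0 \<alpha> (k + r) \<in> Hom (End_cat A) (P (p + k + r)) (P (q + k + r))"
    and \<alpha>s: "place 0 \<alpha> (k + s) \<in> Hom (End_cat A) (P (p + k + s)) (P (q + k + s))"
    by (rule place_in[OF \<alpha>]; simp)+
  have \<beta>p: "place (p + k) \<beta> 0 \<in> Hom (End_cat A) (P (p + k + r)) (P (p + k + s))"
    and \<beta>q: "place (q + k) \<beta> 0 \<in> Hom (End_cat A) (P (q + k + r)) (P (q + k + s))"
    by (rule place_in[OF \<beta>]; simp)+
  have "place i (place 0 \<alpha> (k + s)) j \<bullet> place i (place (p + k) \<beta> 0) j =
      place i (place (q + k) \<beta> 0) j \<bullet> place i (place 0 \<alpha> (k + r)) j"
    using arg_cong[OF eq, of "\<lambda>\<gamma>. place i \<gamma> j"]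
    by (simp only: place_Compose[OF \<beta>p \<alpha>s] place_Compose[OF \<alpha>r \<beta>q])
  then show ?thesis
    by (simp add: place_place[OF \<alpha>] place_place[OF \<beta>] idx add.assoc)
qed

lemma Cpt_place_left:
  assumes "\<alpha> \<in> Hom (End_cat A) (P p) (P q)" "M \<in> Obj A"
  shows "Cpt (place (Suc 0) \<alpha> 0) M = FArr G (Cpt \<alpha> M)"
  using assms(2) unfolding pow_1 by (simp add: Cpt_whisker) (simp add: fctr_pow.simps id_fctr_def)

lemma Cpt_place_right:
  assumes "\<alpha> \<in> Hom (End_cat A) (P p) (P q)" "M \<in> Obj A"
  shows "Cpt (place 0 \<alpha> (Suc 0)) M = Cpt \<alpha> (FObj G M)"
proof -
  have "Cpt \<alpha> (FObj G M) \<in> Arr A"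
    using Cpt_Hom[OF assms(1) FObj_in[OF assms(2)]] by (simp add: Hom_def)
  then show ?thesis
    using assms(2) unfolding pow_1 by (simp add: Cpt_whisker) (simp add: fctr_pow.simps id_fctr_def)
qed

end

section \<open>The simplicial endofunctor of a comonad\<close>

context comonad
begin

sublocale endofunctor A G
  by (rule endofunctor.intro[OF G_functor])

abbreviation d where "d \<equiv> comonad_face A G \<epsilon>"
abbreviation s where "s \<equiv> comonad_degen A G \<delta>"

lemma counit_Hom: "\<epsilon> \<in> Hom (End_cat A) (P (Suc 0)) (P 0)"
  using \<epsilon>_in unfolding pow_1 by (simp add: fctr_pow.simps)

lemma comult_Hom: "\<delta> \<in> Hom (End_cat A) (P (Suc 0)) (P (Suc (Suc 0)))"
  using \<delta>_in unfolding pow_1 pow_2 .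

lemma face_in: "i \<le> n \<Longrightarrow> d n i \<in> Hom (End_cat A) (P (Suc n)) (P n)"
  unfolding comonad_face_def by (rule place_in[OF counit_Hom]) simp_all

lemma degen_in: "i \<le> n \<Longrightarrow> s n i \<in> Hom (End_cat A) (P (Suc n)) (P (Suc (Suc n)))"
  unfolding comonad_degen_def by (rule place_in[OF comult_Hom]) simp_all

lemma place_comult_in:
  "place 0 \<delta> (Suc 0) \<in> Hom (End_cat A) (P (Suc (Suc 0))) (P (Suc (Suc (Suc 0))))"
  "place (Suc 0) \<delta> 0 \<in> Hom (End_cat A) (P (Suc (Suc 0))) (P (Suc (Suc (Suc 0))))"
  by (rule place_in[OF comult_Hom]; simp)+

lemma place_counit_in:
  "place 0 \<epsilon> (Suc 0) \<in> Hom (End_cat A) (P (Suc (Suc 0))) (P (Suc 0))"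
  "place (Suc 0) \<epsilon> 0 \<in> Hom (End_cat A) (P (Suc (Suc 0))) (P (Suc 0))"
  by (rule place_in[OF counit_Hom]; simp)+

text \<open>The laws at each object become equations between natural transformations, which can then be
  placed at any strands.\<close>

lemma coassoc_End: "place 0 \<delta> (Suc 0) \<bullet> \<delta> = place (Suc 0) \<delta> 0 \<bullet> \<delta>"
  by (rule ntrans_eqI[OF E.Compose_in E.Compose_in,
        OF comult_Hom place_comult_in(1) comult_Hom place_comult_in(2)])
    (simp add: Cpt_Compose Cpt_place_left[OF comult_Hom] Cpt_place_right[OF comult_Hom] coassoc)

lemma counit_left_End: "place 0 \<epsilon> (Suc 0) \<bullet> \<delta> = Ident (End_cat A) (P (Suc 0))"
  by (rule ntrans_eqI[OF E.Compose_in E.Ident_in,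
        OF comult_Hom place_counit_in(1) pow_Obj])
    (simp add: Cpt_Compose Cpt_Ident Cpt_place_right[OF counit_Hom] counit_left
        arg_cong[OF pow_1, of "\<lambda>F. FObj F M" for M])

lemma counit_right_End: "place (Suc 0) \<epsilon> 0 \<bullet> \<delta> = Ident (End_cat A) (P (Suc 0))"
  by (rule ntrans_eqI[OF E.Compose_in E.Ident_in,
        OF comult_Hom place_counit_in(2) pow_Obj])
    (simp add: Cpt_Compose Cpt_Ident Cpt_place_left[OF counit_Hom] counit_right
        arg_cong[OF pow_1, of "\<lambda>F. FObj F M" for M])

text \<open>Simplicial identities between operators at different strands are instances of the
  interchange law; the remaining ones are the comonad laws, placed at strand \<open>j\<close>.\<close>

theorem comonad_simplicial_object: "simplicial_object (End_cat A) (comonad_obj A G) d s"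
proof
  show "comonad_obj A G n \<in> Obj (End_cat A)" for n
    unfolding comonad_obj_def using pow_Obj .
  show "d (Suc n) i \<in> Hom (End_cat A) (comonad_obj A G (Suc n)) (comonad_obj A G n)"
    if "i \<le> Suc n" for i n
    using face_in[OF that] by (simp add: comonad_obj_def)
  show "s n i \<in> Hom (End_cat A) (comonad_obj A G n) (comonad_obj A G (Suc n))"
    if "i \<le> n" for i n
    using degen_in[OF that] by (simp add: comonad_obj_def)
  show "d (Suc n) i \<bullet> d (Suc (Suc n)) j = d (Suc n) (j - 1) \<bullet> d (Suc (Suc n)) i"
    if "i < j" "j \<le> Suc (Suc n)" for i j n
    unfolding comonad_face_def
    by (rule place_interchange[OF counit_Hom counit_Hom, where k="j - Suc i"])
      (use that in simp_all)
  show "d (Suc (Suc n)) i \<bullet> s (Suc n) j = s n (j - 1) \<bullet> d (Suc n) i"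
    if "i < j" "j \<le> Suc n" for i j n
    unfolding comonad_face_def comonad_degen_def
    by (rule place_interchange[OF counit_Hom comult_Hom, where k="j - Suc i"])
      (use that in simp_all)
  show "d (Suc (Suc n)) i \<bullet> s (Suc n) j = s n j \<bullet> d (Suc n) (i - 1)"
    if "Suc j < i" "i \<le> Suc (Suc n)" for i j n
    unfolding comonad_face_def comonad_degen_def
    by (rule place_interchange[OF comult_Hom counit_Hom, where k="i - Suc (Suc j)", symmetric])
      (use that in simp_all)
  show "s (Suc n) i \<bullet> s n j = s (Suc n) (Suc j) \<bullet> s n i" if "i \<le> j" "j \<le> n" for i j n
  proof (cases "i = j")
    case True
    have "place j (place 0 \<delta> (Suc 0) \<bullet> \<delta>) (n - j) = place j (place (Suc 0) \<delta> 0 \<bullet> \<delta>) (n - j)"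
      unfolding coassoc_End ..
    then show ?thesis
      using that True
      by (simp add: comonad_degen_def place_place[OF comult_Hom] Suc_diff_le
          place_Compose[OF comult_Hom place_comult_in(1)]
          place_Compose[OF comult_Hom place_comult_in(2)])
  next
    case False
    show ?thesis
      unfolding comonad_degen_def
      by (rule place_interchange[OF comult_Hom comult_Hom, where k="j - Suc i"])
        (use that False in simp_all)
  qed
  show "d (Suc n) j \<bullet> s n j = Ident (End_cat A) (comonad_obj A G n)" if "j \<le> n" for j n
  proof -
    have "place j (place 0 \<epsilon> (Suc 0) \<bullet> \<delta>) (n - j) = Ident (End_cat A) (P (Suc n))"
      unfolding counit_left_End place_Ident using that by simp
    then show ?thesis
      using that
      by (simp add: comonad_degen_def comonad_face_def comonad_obj_def place_place[OF counit_Hom]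
          Suc_diff_le place_Compose[OF comult_Hom place_counit_in(1)])
  qed
  show "d (Suc n) (Suc j) \<bullet> s n j = Ident (End_cat A) (comonad_obj A G n)" if "j \<le> n" for j n
  proof -
    have "place j (place (Suc 0) \<epsilon> 0 \<bullet> \<delta>) (n - j) = Ident (End_cat A) (P (Suc n))"
      unfolding counit_right_End place_Ident using that by simp
    then show ?thesis
      using that
      by (simp add: comonad_degen_def comonad_face_def comonad_obj_def place_place[OF counit_Hom]
          place_Compose[OF comult_Hom place_counit_in(2)])
  qed
qed

text \<open>Both sides remove the two strands of \<open>G\<^sup>2\<close>, in different orders.\<close>

lemma augmentation: "\<epsilon> \<bullet> d 1 0 = \<epsilon> \<bullet> d 1 1"
proof -
  have "place 0 \<epsilon> 0 \<bullet> place (Suc 0) \<epsilon> 0 = place 0 \<epsilon> 0 \<bullet> place 0 \<epsilon> (Suc 0)"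
    by (rule place_interchange[OF counit_Hom counit_Hom, where k=0]) simp_all
  then show ?thesis
    by (simp add: comonad_face_def place_0[OF counit_Hom])
qed

end

section \<open>Involutive symmetries of a comonad\<close>

text \<open>The transformation \<open>t\<close> acts as a crossing of two adjacent strands. The laws say that crossings
  satisfy the relations of simple transpositions, and that deleting or doubling a strand after a
  crossing amounts to doing so before it.\<close>

locale comonad_symmetry = comonad A G \<delta> \<epsilon>
  for A :: "('o, 'm) cat" (structure) and G \<delta> \<epsilon> +
  fixes t :: "('o, 'm, 'o, 'm) ntrans"
  assumes t_in: "t \<in> Hom (End_cat A) (comp_fctr A G G) (comp_fctr A G G)"
    and t_invol: "t \<bullet> t = Ident (End_cat A) (comp_fctr A G G)"
    and t_counit: "M \<in> Obj A \<Longrightarrow> FArr G (Cpt \<epsilon> M) \<cdot> Cpt t M = Cpt \<epsilon> (FObj G M)"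
    and t_comult: "M \<in> Obj A \<Longrightarrow>
      FArr G (Cpt \<delta> M) \<cdot> Cpt t M = Cpt t (FObj G M) \<cdot> FArr G (Cpt t M) \<cdot> Cpt \<delta> (FObj G M)"
    and t_braid: "M \<in> Obj A \<Longrightarrow>
      FArr G (Cpt t M) \<cdot> Cpt t (FObj G M) \<cdot> FArr G (Cpt t M) =
        Cpt t (FObj G M) \<cdot> FArr G (Cpt t M) \<cdot> Cpt t (FObj G M)"
begin

lemma t_Hom: "t \<in> Hom (End_cat A) (P (Suc (Suc 0))) (P (Suc (Suc 0)))"
  using t_in unfolding pow_2 .

lemma place_t_in:
  "place 0 t (Suc 0) \<in> Hom (End_cat A) (P (Suc (Suc (Suc 0)))) (P (Suc (Suc (Suc 0))))"
  "place (Suc 0) t 0 \<in> Hom (End_cat A) (P (Suc (Suc (Suc 0)))) (P (Suc (Suc (Suc 0))))"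
  by (rule place_in[OF t_Hom]; simp)+

lemma t_counit_End: "place (Suc 0) \<epsilon> 0 \<bullet> t = place 0 \<epsilon> (Suc 0)"
  by (rule ntrans_eqI[OF E.Compose_in, OF t_Hom place_counit_in(2) place_counit_in(1)])
    (simp add: Cpt_Compose Cpt_place_left[OF counit_Hom] Cpt_place_right[OF counit_Hom] t_counit)

lemma t_comult_End:
  "place (Suc 0) \<delta> 0 \<bullet> t = place 0 t (Suc 0) \<bullet> place (Suc 0) t 0 \<bullet> place 0 \<delta> (Suc 0)"
  by (rule ntrans_eqI[OF E.Compose_in E.Compose_in[OF E.Compose_in],
        OF t_Hom place_comult_in(2) place_comult_in(1) place_t_in(2) place_t_in(1)])
    (simp add: Cpt_Compose Cpt_place_left[OF comult_Hom] Cpt_place_right[OF comult_Hom]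
      Cpt_place_left[OF t_Hom] Cpt_place_right[OF t_Hom] t_comult)

lemma t_braid_End:
  "place (Suc 0) t 0 \<bullet> place 0 t (Suc 0) \<bullet> place (Suc 0) t 0 =
    place 0 t (Suc 0) \<bullet> place (Suc 0) t 0 \<bullet> place 0 t (Suc 0)"
  by (rule ntrans_eqI[OF E.Compose_in[OF E.Compose_in] E.Compose_in[OF E.Compose_in],
        OF place_t_in(2) place_t_in(1) place_t_in(2) place_t_in(1) place_t_in(2) place_t_in(1)])
    (simp add: Cpt_Compose Cpt_place_left[OF t_Hom] Cpt_place_right[OF t_Hom] t_braid)

text \<open>The crossing of the strands \<open>k\<close> and \<open>k + 1\<close> among the \<open>n + 1\<close> strands of \<open>G\<^bsup>n+1\<^esup>\<close>.\<close>

abbreviation \<tau> where "\<tau> n k \<equiv> place k t (n - Suc k)"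
abbreviation c where "c n k \<equiv> twist_prod A G t n k"

lemma transposition_in: "k < n \<Longrightarrow> \<tau> n k \<in> Hom (End_cat A) (P (Suc n)) (P (Suc n))"
  by (rule place_in[OF t_Hom]) simp_all

lemma transposition_coxeter: "coxeter_generators (End_cat A) (P (Suc n)) (\<tau> n) n"
proof
  show "P (Suc n) \<in> Obj (End_cat A)"
    using pow_Obj .
  show "\<tau> n i \<in> Hom (End_cat A) (P (Suc n)) (P (Suc n))" if "i < n" for i
    using transposition_in[OF that] .
  show "\<tau> n i \<bullet> \<tau> n i = Ident (End_cat A) (P (Suc n))" if "i < n" for i
  proof -
    have "place i (t \<bullet> t) (n - Suc i) = Ident (End_cat A) (P (Suc n))"
      unfolding t_invol pow_2[symmetric] place_Ident using that by simp
    then show ?thesis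
      by (simp add: place_Compose[OF t_Hom t_Hom])
  qed
  show "\<tau> n (Suc i) \<bullet> \<tau> n i \<bullet> \<tau> n (Suc i) = \<tau> n i \<bullet> \<tau> n (Suc i) \<bullet> \<tau> n i" if "Suc i < n" for i
  proof -
    define j where "j = n - Suc (Suc i)"
    have j: "n - Suc i = Suc j" "n - Suc (Suc i) = j"
      using that by (simp_all add: j_def)
    note comp = E.Compose_in[OF place_t_in(2) place_t_in(1)]
      E.Compose_in[OF place_t_in(1) place_t_in(2)]
    show ?thesis
      unfolding j
      using arg_cong[OF t_braid_End, of "\<lambda>\<gamma>. place i \<gamma> j"]
      by (simp add: place_Compose[OF comp(1) place_t_in(2)] place_Compose[OF comp(2) place_t_in(1)]
          place_Compose[OF place_t_in(2) place_t_in(1)]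
          place_Compose[OF place_t_in(1) place_t_in(2)] place_place[OF t_Hom])
  qed
  show "\<tau> n i \<bullet> \<tau> n j = \<tau> n j \<bullet> \<tau> n i" if "Suc i < j" "j < n" for i j
    by (rule place_interchange[OF t_Hom t_Hom, where k="j - Suc (Suc i)"])
      (use that in simp_all)
qed

lemma twist_prod_up_prod: "c n k = up_prod (End_cat A) (P (Suc n)) (\<tau> n) k"
  by (induction k) simp_all

lemma twist_prod_in: "k \<le> n \<Longrightarrow> c n k \<in> Hom (End_cat A) (P (Suc n)) (P (Suc n))"
  unfolding twist_prod_up_prod
  by (rule coxeter_generators.c_in[OF transposition_coxeter])

text \<open>A face operator passes a crossing of other strands by interchange, and it turns a crossing
  with the strand that it deletes into a face at the neighbouring position.\<close>

lemma face_transposition_after: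
  "k < n \<Longrightarrow> Suc k < i \<Longrightarrow> i \<le> Suc n \<Longrightarrow> d (Suc n) i \<bullet> \<tau> (Suc n) k = \<tau> n k \<bullet> d (Suc n) i"
  unfolding comonad_face_def
  by (rule place_interchange[OF t_Hom counit_Hom, where k="i - Suc (Suc k)", symmetric]) simp_all

lemma face_transposition_before:
  "i \<le> k \<Longrightarrow> k < n \<Longrightarrow> d (Suc n) i \<bullet> \<tau> (Suc n) (Suc k) = \<tau> n k \<bullet> d (Suc n) i"
  unfolding comonad_face_def
  by (rule place_interchange[OF counit_Hom t_Hom, where k="k - i"]) simp_all

lemma face_transposition_at:
  assumes "i \<le> n"
  shows "d (Suc n) (Suc i) \<bullet> \<tau> (Suc n) i = d (Suc n) i"
  using arg_cong[OF t_counit_End, of "\<lambda>\<gamma>. place i \<gamma> (n - i)"] assms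
  by (simp add: place_Compose[OF t_Hom place_counit_in(2)] place_place[OF counit_Hom]
      comonad_face_def Suc_diff_le)

text \<open>A degeneracy passes a crossing of other strands by interchange. Doubling a strand that
  crosses another one is the same as doubling it first and then letting both copies cross.\<close>

lemma degen_transposition_after:
  "Suc k < i \<Longrightarrow> i \<le> n \<Longrightarrow> s n i \<bullet> \<tau> n k = \<tau> (Suc n) k \<bullet> s n i"
  unfolding comonad_degen_def
  by (rule place_interchange[OF t_Hom comult_Hom, where k="i - Suc (Suc k)", symmetric]) simp_all

lemma degen_transposition_before:
  "i < k \<Longrightarrow> k < n \<Longrightarrow> s n i \<bullet> \<tau> n k = \<tau> (Suc n) (Suc k) \<bullet> s n i"
  unfolding comonad_degen_def
  by (rule place_interchange[OF comult_Hom t_Hom, where k="k - Suc i"]) simp_all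

lemma degen_transposition_at:
  assumes "i < n"
  shows "s n (Suc i) \<bullet> \<tau> n i = \<tau> (Suc n) i \<bullet> \<tau> (Suc n) (Suc i) \<bullet> s n i"
proof -
  note comp = E.Compose_in[OF place_comult_in(1) place_t_in(2)]
  obtain j where j: "n = Suc (i + j)"
    using assms less_iff_Suc_add by auto
  have "Suc (i + j) - i = Suc j"
    by simp
  then show ?thesis
    using arg_cong[OF t_comult_End, of "\<lambda>\<gamma>. place i \<gamma> j"]
    by (simp add: j place_Compose[OF t_Hom place_comult_in(2)] place_Compose[OF comp place_t_in(1)]
        place_Compose[OF place_comult_in(1) place_t_in(2)] place_place[OF t_Hom]
        place_place[OF comult_Hom] comonad_degen_def)
qed

text \<open>The crossings in \<open>c (Suc n) k\<close> only involve the strands up to \<open>k\<close>, which come before the one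
  that is deleted.\<close>

lemma face_twist_prod_after:
  assumes "k < i" "i \<le> Suc n"
  shows "d (Suc n) i \<bullet> c (Suc n) k = c n k \<bullet> d (Suc n) i"
  using \<open>k < i\<close>
proof (induction k)
  case 0
  show ?case
    using E.Ident_left[OF face_in] E.Ident_right[OF face_in] assms by simp
next
  case (Suc k)
  have D: "d (Suc n) i \<in> Hom (End_cat A) (P (Suc (Suc n))) (P (Suc n))"
    using face_in assms by simp
  have k: "k < n" "k < Suc n" "k \<le> n" "k \<le> Suc n"
    using Suc assms by simp_all
  note C = twist_prod_in[OF k(3)] twist_prod_in[OF k(4)]
    and T = transposition_in[OF k(1)] transposition_in[OF k(2)]
  have "d (Suc n) i \<bullet> c (Suc n) (Suc k) = (d (Suc n) i \<bullet> c (Suc n) k) \<bullet> \<tau> (Suc n) k"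
    using E.Compose_assoc[OF T(2) C(2) D] by simp
  also have "\<dots> = c n k \<bullet> d (Suc n) i \<bullet> \<tau> (Suc n) k"
    using Suc E.Compose_assoc[OF T(2) D C(1)] by simp
  also have "\<dots> = c n (Suc k) \<bullet> d (Suc n) i"
    using face_transposition_after[OF k(1) Suc.prems assms(2)] E.Compose_assoc[OF D T(1) C(1)]
    by simp
  finally show ?case .
qed

text \<open>The crossing \<open>\<tau> (Suc n) i\<close> is absorbed by the face at \<open>Suc i\<close>. After this the face sits at
  \<open>i\<close>, before all further crossings, and lowers their index by one; so the product loses exactly one
  factor.\<close>

lemma face_twist_prod:
  assumes "i \<le> k" "k \<le> n"
  shows "d (Suc n) (Suc i) \<bullet> c (Suc n) (Suc k) = c n k \<bullet> d (Suc n) i"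
  using assms
proof (induction k rule: dec_induct)
  case base
  have i: "i < Suc n" "i \<le> n" "i \<le> Suc n" "Suc i \<le> Suc n"
    using base by simp_all
  note D = face_in[OF i(4)] and C = twist_prod_in[OF i(2)] twist_prod_in[OF i(3)]
    and T = transposition_in[OF i(1)]
  have "d (Suc n) (Suc i) \<bullet> c (Suc n) (Suc i) = (d (Suc n) (Suc i) \<bullet> c (Suc n) i) \<bullet> \<tau> (Suc n) i"
    using E.Compose_assoc[OF T C(2) D] by simp
  also have "\<dots> = c n i \<bullet> d (Suc n) (Suc i) \<bullet> \<tau> (Suc n) i"
    using face_twist_prod_after[of i "Suc i" n] base E.Compose_assoc[OF T D C(1)] by simp
  also have "\<dots> = c n i \<bullet> d (Suc n) i"
    using face_transposition_at[OF i(2)] by simp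
  finally show ?case .
next
  case (step k)
  have k: "Suc i \<le> Suc n" "i \<le> Suc n" "k < n" "k \<le> n" "Suc k \<le> Suc n" "Suc k < Suc n"
    using step by simp_all
  note D = face_in[OF k(1)] face_in[OF k(2)]
    and C = twist_prod_in[OF k(4)] twist_prod_in[OF k(5)]
    and T = transposition_in[OF k(3)] transposition_in[OF k(6)]
  have "d (Suc n) (Suc i) \<bullet> c (Suc n) (Suc (Suc k)) =
      (d (Suc n) (Suc i) \<bullet> c (Suc n) (Suc k)) \<bullet> \<tau> (Suc n) (Suc k)"
    using E.Compose_assoc[OF T(2) C(2) D(1)] twist_prod.simps(2)[of A G t "Suc n" "Suc k"] by simp
  also have "\<dots> = c n k \<bullet> d (Suc n) i \<bullet> \<tau> (Suc n) (Suc k)"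
    using step E.Compose_assoc[OF T(2) D(2) C(1)] by simp
  also have "\<dots> = c n (Suc k) \<bullet> d (Suc n) i"
    using face_transposition_before[OF step(1) k(3)] E.Compose_assoc[OF D(2) T(1) C(1)] by simp
  finally show ?case .
qed

lemma degen_twist_prod_after:
  assumes "k < i" "i \<le> n"
  shows "s n i \<bullet> c n k = c (Suc n) k \<bullet> s n i"
  using \<open>k < i\<close>
proof (induction k)
  case 0
  show ?case
    using E.Ident_left[OF degen_in] E.Ident_right[OF degen_in] assms by simp
next
  case (Suc k)
  have k: "k < n" "k < Suc n" "k \<le> n" "k \<le> Suc n"
    using Suc assms by simp_all
  note D = degen_in[OF assms(2)] and C = twist_prod_in[OF k(3)] twist_prod_in[OF k(4)]
    and T = transposition_in[OF k(1)] transposition_in[OF k(2)]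
  have "s n i \<bullet> c n (Suc k) = (s n i \<bullet> c n k) \<bullet> \<tau> n k"
    using E.Compose_assoc[OF T(1) C(1) D] by simp
  also have "\<dots> = c (Suc n) k \<bullet> s n i \<bullet> \<tau> n k"
    using Suc E.Compose_assoc[OF T(1) D C(2)] by simp
  also have "\<dots> = c (Suc n) (Suc k) \<bullet> s n i"
    using degen_transposition_after[OF Suc.prems assms(2)] E.Compose_assoc[OF D T(2) C(2)]
    by simp
  finally show ?case .
qed

text \<open>The crossing \<open>\<tau> n i\<close> is doubled by the degeneracy at \<open>Suc i\<close>. After this the degeneracy sits at
  \<open>i\<close>, before all further crossings, and raises their index by one; so the product gains exactly one
  factor.\<close>

lemma degen_twist_prod:
  assumes "Suc i \<le> k" "k \<le> n"
  shows "s n (Suc i) \<bullet> c n k = c (Suc n) (Suc k) \<bullet> s n i"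
  using assms
proof (induction k rule: dec_induct)
  case base
  have i: "i < n" "i < Suc n" "Suc i < Suc n" "i \<le> n" "i \<le> Suc n" "Suc i \<le> n" "Suc i \<le> Suc n"
    using base by simp_all
  note D = degen_in[OF i(4)] degen_in[OF i(6)]
    and C = twist_prod_in[OF i(4)] twist_prod_in[OF i(5)] twist_prod_in[OF i(7)]
    and T = transposition_in[OF i(1)] transposition_in[OF i(2)] transposition_in[OF i(3)]
  have "s n (Suc i) \<bullet> c n (Suc i) = (s n (Suc i) \<bullet> c n i) \<bullet> \<tau> n i"
    using E.Compose_assoc[OF T(1) C(1) D(2)] by simp
  also have "\<dots> = c (Suc n) i \<bullet> s n (Suc i) \<bullet> \<tau> n i"
    using degen_twist_prod_after[of i "Suc i" n] base E.Compose_assoc[OF T(1) D(2) C(2)] by simp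
  also have "\<dots> = c (Suc n) i \<bullet> \<tau> (Suc n) i \<bullet> \<tau> (Suc n) (Suc i) \<bullet> s n i"
    using degen_transposition_at[OF i(1)] by simp
  also have "\<dots> = c (Suc n) (Suc i) \<bullet> \<tau> (Suc n) (Suc i) \<bullet> s n i"
    using E.Compose_assoc[OF E.Compose_in[OF D(1) T(3)] T(2) C(2)] by simp
  also have "\<dots> = c (Suc n) (Suc (Suc i)) \<bullet> s n i"
    using E.Compose_assoc[OF D(1) T(3) C(3)] twist_prod.simps(2)[of A G t "Suc n" "Suc i"] by simp
  finally show ?case .
next
  case (step k)
  have k: "i \<le> n" "Suc i \<le> n" "k < n" "k \<le> n" "Suc k \<le> Suc n" "Suc k < Suc n"
    using step by simp_all
  note D = degen_in[OF k(1)] degen_in[OF k(2)]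
    and C = twist_prod_in[OF k(4)] twist_prod_in[OF k(5)]
    and T = transposition_in[OF k(3)] transposition_in[OF k(6)]
  have "s n (Suc i) \<bullet> c n (Suc k) = (s n (Suc i) \<bullet> c n k) \<bullet> \<tau> n k"
    using E.Compose_assoc[OF T(1) C(1) D(2)] by simp
  also have "\<dots> = c (Suc n) (Suc k) \<bullet> s n i \<bullet> \<tau> n k"
    using step E.Compose_assoc[OF T(1) D(1) C(2)] by simp
  also have "\<dots> = c (Suc n) (Suc (Suc k)) \<bullet> s n i"
    using degen_transposition_before[of i k n] step E.Compose_assoc[OF D(1) T(2) C(2)]
      twist_prod.simps(2)[of A G t "Suc n" "Suc k"] by simp
  finally show ?case .
qed

lemma twist_op_order:
  "arr_pow (End_cat A) (twist_op A G t n) (n + 1) = Ident (End_cat A) (comonad_obj A G n)"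
  using coxeter_generators.coxeter_element_order[OF transposition_coxeter, of n n]
  by (simp add: twist_op_def twist_prod_up_prod comonad_obj_def
      del: arr_pow.simps up_prod.simps)

theorem comonad_augmented_cyclic_object:
  "augmented_cyclic_object (End_cat A) (comonad_obj A G) d s (twist_op A G t) (id_fctr A) \<epsilon>"
proof -
  interpret S: simplicial_object "End_cat A" "comonad_obj A G" d s
    by (rule comonad_simplicial_object)
  interpret cyclic_object "End_cat A" "comonad_obj A G" d s "twist_op A G t"
  proof (rule S.cyclic_objectI)
    show "twist_op A G t 0 = Ident (End_cat A) (comonad_obj A G 0)"
      by (simp add: twist_op_def comonad_obj_def)
    show "twist_op A G t n \<in> Hom (End_cat A) (comonad_obj A G n) (comonad_obj A G n)" for n
      using twist_prod_in[of n n] by (simp add: twist_op_def comonad_obj_def)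
    show "d n i \<bullet> twist_op A G t n = twist_op A G t (n - 1) \<bullet> d n (i - 1)"
      if "n \<ge> 1" "0 < i" "i \<le> n" for n i
      using that face_twist_prod[of "i - 1" "n - 1" "n - 1"] by (simp add: twist_op_def)
    show "s n i \<bullet> twist_op A G t n = twist_op A G t (n + 1) \<bullet> s n (i - 1)"
      if "n \<ge> 1" "0 < i" "i \<le> n" for n i
      using that degen_twist_prod[of "i - 1" n n]
      by (simp add: twist_op_def del: twist_prod.simps)
    show "arr_pow (End_cat A) (twist_op A G t n) (n + 1) =
        Ident (End_cat A) (comonad_obj A G n)" for n
      by (rule twist_op_order)
  qed
  show ?thesis
  proof
    show "id_fctr A \<in> Obj (End_cat A)"
      using pow_Obj[of 0] by (simp add: fctr_pow.simps)
    show "\<epsilon> \<in> Hom (End_cat A) (comonad_obj A G 0) (id_fctr A)"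
      using counit_Hom by (simp add: comonad_obj_def fctr_pow.simps(1))
    show "\<epsilon> \<bullet> d 1 0 = \<epsilon> \<bullet> d 1 1"
      by (rule augmentation)
  qed
qed

end

theorem theorem2:
  fixes A :: "('o, 'm) cat" (structure)
    and G :: "('o, 'm, 'o, 'm) fctr"
    and \<delta> \<epsilon> t :: "('o, 'm, 'o, 'm) ntrans"
  assumes "comonad A G \<delta> \<epsilon>"
    and "t \<in> iso_in (End_cat A) (comp_fctr A G G) (comp_fctr A G G)"
    and "\<And>M. M \<in> Obj A \<Longrightarrow> FArr G (Cpt \<epsilon> M) \<cdot> Cpt t M = Cpt \<epsilon> (FObj G M)"
    and "\<And>M. M \<in> Obj A \<Longrightarrow> Cpt \<epsilon> (FObj G M) \<cdot> Cpt t M = FArr G (Cpt \<epsilon> M)"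
    and "\<And>M. M \<in> Obj A \<Longrightarrow>
      FArr G (Cpt \<delta> M) \<cdot> Cpt t M = Cpt t (FObj G M) \<cdot> FArr G (Cpt t M) \<cdot> Cpt \<delta> (FObj G M)"
    and "\<And>M. M \<in> Obj A \<Longrightarrow>
      Cpt \<delta> (FObj G M) \<cdot> Cpt t M =
        Cpt t (FObj G M) \<cdot> FArr G (Cpt t M) \<cdot> Cpt t (FObj G M) \<cdot> FArr G (Cpt t M) \<cdot> FArr G (Cpt \<delta> M)"
    and "\<And>M. M \<in> Obj A \<Longrightarrow>
      FArr G (Cpt t M) \<cdot> Cpt t (FObj G M) \<cdot> FArr G (Cpt t M) =
        Cpt t (FObj G M) \<cdot> FArr G (Cpt t M) \<cdot> Cpt t (FObj G M)"
    and "\<And>M. M \<in> Obj A \<Longrightarrow> Cpt t M \<cdot> Cpt t M \<cdot> Cpt t M \<cdot> Cpt \<delta> M = Cpt t M \<cdot> Cpt \<delta> M"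
    and "arr_pow (End_cat A) t 2 = Ident (End_cat A) (comp_fctr A G G)"
  shows "(\<forall>n\<ge>1. arr_pow (End_cat A) (twist_op A G t n) (n + 1) =
              Ident (End_cat A) (comonad_obj A G n)) \<and>
    augmented_cyclic_object (End_cat A) (comonad_obj A G) (comonad_face A G \<epsilon>)
      (comonad_degen A G \<delta>) (twist_op A G t) (id_fctr A) \<epsilon>"
proof -
  interpret comonad A G \<delta> \<epsilon> by fact
  have t: "t \<in> Hom (End_cat A) (comp_fctr A G G) (comp_fctr A G G)"
    using assms(2) by (simp add: iso_in_def)
  have "t \<bullet> t = Ident (End_cat A) (comp_fctr A G G)"
    using assms(9) E.arr_pow_1[OF t] by (simp add: numeral_2_eq_2)
  then interpret comonad_symmetry A G \<delta> \<epsilon> t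
    by unfold_locales (use t assms(3,5,7) in auto)
  show ?thesis
    using twist_op_order comonad_augmented_cyclic_object by blast
qed

end
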